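(* Let $k$ be a field, let $a,b,c$ be positive integers, and let $I = (x^a, y)\cap (y^b, z)\cap (z^c, x) \subseteq k[x,y,z]$. Then: (i) $\operatorname{sdef}_I(n) \sim (\alpha+\beta+\gamma)\,n$, where $$(\alpha,\beta,\gamma) = \left(\frac{a(bc-b+1)}{abc+1}, \frac{b(ac-c+1)}{abc+1}, \frac{c(ab-a+1)}{abc+1}\right);$$ (ii) $abc+1$ is a quasi-period of $\operatorname{sdef}_I(n)$.
   Context: Let $R=k[x,y,z]$ and $\mathfrak m=(x,y,z)$. For an ideal $I$ of $R$, $I^{(n)} := \bigcap_{\mathfrak p \in \operatorname{Ass}(R/I)} (I^n R_{\mathfrak p} \cap R)$ is the $n$-th symbolic power, and $\operatorname{sdef}_I(n) := \mu(I^{(n)}/I^n)$, where $\mu(M)=\dim_k(M/\mathfrak m M)$ is the minimal number of generators of a finitely generated graded module $M$. For functions $f,g$ of $n$, $f(n)\sim g(n)$ means $\lim_{n\to\infty} f(n)/g(n)=1$. For a monomial ideal $I$ the function $\operatorname{sdef}_I$ is eventually quasi-polynomial; a positive integer $N$ is a quasi-period of $\operatorname{sdef}_I$ if there are polynomials $p_0,\ldots,p_{N-1}$ such that $\operatorname{sdef}_I(n) = p_{n \bmod N}(n)$ for all sufficiently large $n$ ($N$ need not be the minimal such integer). *)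

theory Defs
  imports
    "Jordan_Normal_Form.VS_Connect"
    "HOL-Algebra.Ideal_Product"
    "HOL-Algebra.QuotRing"
    "HOL-Library.Poly_Mapping"
    "HOL-Library.Numeral_Type"
    "HOL-Computational_Algebra.Fraction_Field"
    Complex_Main
begin

section \<open>The polynomial ring in three variables\<close>

text \<open>
  Exponent vectors are maps from the three-element type \<^typ>\<open>3\<close> to the naturals, so
  \<open>'k poly3\<close> is the monoid algebra of \<open>\<nat>\<^sup>3\<close> over \<open>'k\<close>, with convolution as product.
\<close>

type_synonym 'k poly3 = "(3 \<Rightarrow>\<^sub>0 nat) \<Rightarrow>\<^sub>0 'k"

definition var :: "3 \<Rightarrow> 'k::field poly3"
  where "var i = Poly_Mapping.single (Poly_Mapping.single i 1) 1"

abbreviation varx :: "'k::field poly3" where "varx \<equiv> var 0"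
abbreviation vary :: "'k::field poly3" where "vary \<equiv> var 1"
abbreviation varz :: "'k::field poly3" where "varz \<equiv> var 2"

definition const_poly :: "'k::field \<Rightarrow> 'k poly3"
  where "const_poly c = Poly_Mapping.single 0 c"

definition max_ideal :: "'k::field poly3 set"
  where "max_ideal = Idl\<^bsub>class_ring\<^esub> {varx, vary, varz}"


section \<open>Modules\<close>

text \<open>
  Module records of the algebra library extend ring records; the fields \<open>mult\<close> and \<open>one\<close> play no
  role in the module structure and are filled arbitrarily below.
\<close>

definition ideal_module :: "('a, 'r) ring_scheme \<Rightarrow> 'a set \<Rightarrow> ('a, 'a) module"
  where "ideal_module R J =
    \<lparr>carrier = J, monoid.mult = monoid.mult R, one = \<one>\<^bsub>R\<^esub>,
     zero = \<zero>\<^bsub>R\<^esub>, add = add R, smult = monoid.mult R\<rparr>"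

definition quot_module :: "('a, 'b, 'm) module_scheme \<Rightarrow> 'b set \<Rightarrow> ('a, 'b set) module"
  where "quot_module M N =
    \<lparr>carrier = a_rcosets\<^bsub>M\<^esub> N, monoid.mult = (\<lambda>_ _. N), one = N,
     zero = N, add = set_add M,
     smult = (\<lambda>r C. N <+>\<^bsub>M\<^esub> ((\<lambda>m. r \<odot>\<^bsub>M\<^esub> m) ` C))\<rparr>"

definition restrict_scalars :: "('c \<Rightarrow> 'a) \<Rightarrow> ('a, 'b, 'm) module_scheme \<Rightarrow> ('c, 'b) module"
  where "restrict_scalars \<phi> M =
    \<lparr>carrier = carrier M, monoid.mult = monoid.mult M, one = \<one>\<^bsub>M\<^esub>,
     zero = \<zero>\<^bsub>M\<^esub>, add = add M, smult = (\<lambda>c m. \<phi> c \<odot>\<^bsub>M\<^esub> m)\<rparr>"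

definition ideal_times_module ::
    "('a, 'r) ring_scheme \<Rightarrow> 'a set \<Rightarrow> ('a, 'b, 'm) module_scheme \<Rightarrow> 'b set"
  where "ideal_times_module R J M =
    LinearCombinations.module.span R M {r \<odot>\<^bsub>M\<^esub> m | r m. r \<in> J \<and> m \<in> carrier M}"

definition assoc_primes :: "('a, 'r) ring_scheme \<Rightarrow> ('a, 'b, 'm) module_scheme \<Rightarrow> 'a set set"
  where "assoc_primes R M =
    {P. primeideal P R \<and> (\<exists>m \<in> carrier M. P = {r \<in> carrier R. r \<odot>\<^bsub>M\<^esub> m = \<zero>\<^bsub>M\<^esub>})}"


section \<open>Symbolic powers\<close>

text \<open>For a prime \<open>P\<close> of a domain, the local ring at \<open>P\<close> is taken inside the fraction field.\<close>

definition local_ring :: "'r::idom set \<Rightarrow> 'r fract ring"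
  where "local_ring P = class_ring \<lparr>carrier := {Fract a s | a s. s \<notin> P}\<rparr>"

definition local_contraction :: "'r::idom set \<Rightarrow> 'r set \<Rightarrow> 'r set"
  where "local_contraction P J =
    {r. Fract r 1 \<in> Idl\<^bsub>local_ring P\<^esub> ((\<lambda>f. Fract f 1) ` J)}"

definition ideal_power :: "'r::idom set \<Rightarrow> nat \<Rightarrow> 'r set"
  where "ideal_power I n = I [^]\<^bsub>ideals_set class_ring\<^esub> n"

definition symbolic_power :: "'r::idom set \<Rightarrow> nat \<Rightarrow> 'r set"
  where "symbolic_power I n =
    (\<Inter>P \<in> assoc_primes class_ring (quot_module (ideal_module class_ring UNIV) I).
       local_contraction P (ideal_power I n))"


section \<open>The symbolic defect\<close>

text \<open>
  The minimal number of generators is the \<open>k\<close>-dimension of \<open>M\<close> modulo the maximal ideal times \<open>M\<close>,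
  a \<open>k\<close>-space through the constant polynomials. The dimension function is only meaningful for
  finite-dimensional spaces, so \<open>M\<close> should be finitely generated.
\<close>

definition min_gens :: "('k::field poly3, 'b, 'm) module_scheme \<Rightarrow> nat"
  where "min_gens M =
    vectorspace.dim (class_ring :: 'k ring)
      (restrict_scalars const_poly (quot_module M (ideal_times_module class_ring max_ideal M)))"

definition sdef :: "'k::field poly3 set \<Rightarrow> nat \<Rightarrow> nat"
  where "sdef I n =
    min_gens (quot_module (ideal_module class_ring (symbolic_power I n)) (ideal_power I n))"

definition is_quasi_period :: "(nat \<Rightarrow> nat) \<Rightarrow> nat \<Rightarrow> bool"
  where "is_quasi_period f N \<longleftrightarrow> N > 0 \<and>
    (\<exists>p :: nat \<Rightarrow> real poly. \<forall>\<^sub>F n in sequentially. real (f n) = poly (p (n mod N)) (real n))"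

end

theory Submission
  imports Defs "HOL-Algebra.Subrings"
begin

text \<open>
  \<open>I\<close> is a monomial ideal whose associated primes are \<open>(x,y)\<close>, \<open>(y,z)\<close> and \<open>(z,x)\<close>. At \<open>(x,y)\<close> the
  variable \<open>z\<close> becomes invertible and \<open>I\<^sup>n\<close> becomes \<open>(x\<^sup>a,y)\<^sup>n\<close>, a primary ideal spanned by the monomials
  \<open>x\<^sup>iy\<^sup>jz\<^sup>k\<close> with \<open>n \<le> \<lfloor>i/a\<rfloor> + j\<close>. So the \<open>n\<close>-th symbolic power is spanned by the monomials that satisfy
  this inequality and its two cyclic images (\<open>symbolic_power_symb\<close>), while \<open>I = (xyz, x\<^sup>az, xy\<^sup>b, yz\<^sup>c)\<close>
  makes \<open>I\<^sup>n\<close> explicit (\<open>nsum_symb\<close>). For monomial ideals \<open>K \<subseteq> J\<close>, the minimal generators of \<open>J/K\<close> are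
  the minimal monomials of \<open>J\<close> outside \<open>K\<close> (\<open>min_gens_mono_quot\<close>). The symbolic defect therefore
  counts lattice points (\<open>sdef_eq_card\<close>).

  Without rounding, the three inequalities are all tight at the one point \<open>(n\<alpha>, n\<beta>, n\<gamma>)\<close>. For
  \<open>n = N = abc+1\<close> it is a lattice point \<open>v = (A,B,C)\<close> with \<open>a | A\<close>, \<open>b | B\<close> and \<open>c | C\<close>, so
  translation by \<open>v\<close> commutes with the roundings: it identifies the minimal solutions for \<open>n\<close> with
  those minimal solutions for \<open>n+N\<close> that lie in the octant \<open>v + \<nat>\<^sup>3\<close> (\<open>min_exps_shift\<close>). The remaining
  minimal solutions for \<open>n+N\<close> form three edges: for each \<open>i < A\<close> exactly one, namely
  \<open>(i, n+N-\<lfloor>i/a\<rfloor>, c(n+N-i))\<close>, and cyclically (\<open>min_exps_low\<close>). Hence passing from \<open>n\<close> to \<open>n+N\<close> adds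
  \<open>A+B+C\<close> minimal solutions.

  Few of them lie in \<open>I\<^sup>n\<close>. A minimal solution with positive coordinates makes two of the three
  inequalities tight, and an exponent of \<open>I\<^sup>n\<close> with this property lies outside the octant
  (\<open>tight_power_exps_low\<close>); on an edge the exponents of \<open>I\<^sup>n\<close> are those with \<open>i = 0\<close>, or \<open>b = 1\<close> and
  \<open>i < a\<close>, whose number does not depend on \<open>n\<close> (\<open>low_power_exps\<close>). So on each residue class modulo
  \<open>N\<close> the defect is, for \<open>n \<ge> N\<close>, an affine function of \<open>n\<close> with slope
  \<open>(A+B+C)/N = \<alpha>+\<beta>+\<gamma> > 0\<close> (\<open>card_sdef_exps\<close>), which gives both claims.
\<close>

section \<open>Counting exponents\<close>

definition symb_exps :: "nat \<Rightarrow> nat \<Rightarrow> nat \<Rightarrow> nat \<Rightarrow> (nat \<times> nat \<times> nat) set"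
  where "symb_exps a b c n =
    {(i, j, k). n \<le> i div a + j \<and> n \<le> j div b + k \<and> n \<le> k div c + i}"

text \<open>
  The four summands \<open>p, q, r, s\<close> count the factors \<open>xyz\<close>, \<open>x\<^sup>az\<close>, \<open>xy\<^sup>b\<close>, \<open>yz\<^sup>c\<close> in a product of \<open>n\<close>
  generators of \<open>I\<close>.
\<close>

definition power_exps :: "nat \<Rightarrow> nat \<Rightarrow> nat \<Rightarrow> nat \<Rightarrow> (nat \<times> nat \<times> nat) set"
  where "power_exps a b c n =
    {(i, j, k). \<exists>p q r s. p + q + r + s = n \<and>
       p + a * q + r \<le> i \<and> p + b * r + s \<le> j \<and> p + q + c * s \<le> k}"

definition min_exps :: "nat \<Rightarrow> nat \<Rightarrow> nat \<Rightarrow> nat \<Rightarrow> (nat \<times> nat \<times> nat) set"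
  where "min_exps a b c n =
    {(i, j, k). (i, j, k) \<in> symb_exps a b c n \<and>
       (i > 0 \<longrightarrow> (i - 1, j, k) \<notin> symb_exps a b c n) \<and>
       (j > 0 \<longrightarrow> (i, j - 1, k) \<notin> symb_exps a b c n) \<and>
       (k > 0 \<longrightarrow> (i, j, k - 1) \<notin> symb_exps a b c n)}"

text \<open>
  The cyclic symmetry \<open>x \<rightarrow> y \<rightarrow> z \<rightarrow> x\<close>, \<open>a \<rightarrow> b \<rightarrow> c \<rightarrow> a\<close>: results on the first coordinate transfer
  to the other two.
\<close>

lemma symb_exps_rotate: "(i, j, k) \<in> symb_exps a b c n \<longleftrightarrow> (j, k, i) \<in> symb_exps b c a n"
  by (auto simp: symb_exps_def)

lemma power_exps_rotate_imp:
  assumes "(i, j, k) \<in> power_exps a b c n"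
  shows "(j, k, i) \<in> power_exps b c a n"
proof -
  from assms obtain p q r s where
    "p + q + r + s = n" "p + a * q + r \<le> i" "p + b * r + s \<le> j" "p + q + c * s \<le> k"
    by (auto simp: power_exps_def)
  then have "p + r + s + q = n \<and> p + b * r + s \<le> j \<and> p + c * s + q \<le> k \<and> p + r + a * q \<le> i"
    by auto
  then show ?thesis unfolding power_exps_def by blast
qed

lemma power_exps_rotate: "(i, j, k) \<in> power_exps a b c n \<longleftrightarrow> (j, k, i) \<in> power_exps b c a n"
  using power_exps_rotate_imp by blast

lemma symb_exps_mono:
  assumes "(i, j, k) \<in> symb_exps a b c n" "i \<le> i'" "j \<le> j'" "k \<le> k'"
  shows "(i', j', k') \<in> symb_exps a b c n"
proof -
  have "n \<le> i' div a + j'" "n \<le> j' div b + k'" "n \<le> k' div c + i'"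
    using assms div_le_mono[OF assms(2), of a] div_le_mono[OF assms(3), of b] div_le_mono[OF assms(4), of c]
    unfolding symb_exps_def mem_Collect_eq prod.case by linarith+
  then show ?thesis by (simp add: symb_exps_def)
qed

lemma power_exps_add:
  assumes "(i, j, k) \<in> power_exps a b c m" "(i', j', k') \<in> power_exps a b c n"
  shows "(i + i', j + j', k + k') \<in> power_exps a b c (m + n)"
proof -
  from assms obtain p q r s p' q' r' s' where
    "p + q + r + s = m" "p + a * q + r \<le> i" "p + b * r + s \<le> j" "p + q + c * s \<le> k"
    "p' + q' + r' + s' = n" "p' + a * q' + r' \<le> i'" "p' + b * r' + s' \<le> j'" "p' + q' + c * s' \<le> k'"
    by (auto simp: power_exps_def)
  then have "(p + p') + (q + q') + (r + r') + (s + s') = m + n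
      \<and> (p + p') + a * (q + q') + (r + r') \<le> i + i' \<and> (p + p') + b * (r + r') + (s + s') \<le> j + j'
      \<and> (p + p') + (q + q') + c * (s + s') \<le> k + k'"
    unfolding distrib_left by linarith
  then show ?thesis unfolding power_exps_def by blast
qed

lemma generators_power_exps:
  "(1, 1, 1) \<in> power_exps a b c 1" "(a, 0, 1) \<in> power_exps a b c 1"
  "(1, b, 0) \<in> power_exps a b c 1" "(0, 1, c) \<in> power_exps a b c 1"
proof -
  have "1 + 0 + 0 + 0 = (1::nat) \<and> 1 + a * 0 + 0 \<le> 1 \<and> 1 + b * 0 + 0 \<le> 1 \<and> 1 + 0 + c * 0 \<le> 1"
    by simp
  then show "(1, 1, 1) \<in> power_exps a b c 1" unfolding power_exps_def by blast
  have "0 + 1 + 0 + 0 = (1::nat) \<and> 0 + a * 1 + 0 \<le> a \<and> 0 + b * 0 + 0 \<le> 0 \<and> 0 + 1 + c * 0 \<le> 1"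
    by simp
  then show "(a, 0, 1) \<in> power_exps a b c 1" unfolding power_exps_def by blast
  have "0 + 0 + 1 + 0 = (1::nat) \<and> 0 + a * 0 + 1 \<le> 1 \<and> 0 + b * 1 + 0 \<le> b \<and> 0 + 0 + c * 0 \<le> 0"
    by simp
  then show "(1, b, 0) \<in> power_exps a b c 1" unfolding power_exps_def by blast
  have "0 + 0 + 0 + 1 = (1::nat) \<and> 0 + a * 0 + 0 \<le> 0 \<and> 0 + b * 0 + 1 \<le> 1 \<and> 0 + 0 + c * 1 \<le> c"
    by simp
  then show "(0, 1, c) \<in> power_exps a b c 1" unfolding power_exps_def by blast
qed

lemma power_exps_mono:
  assumes "(i, j, k) \<in> power_exps a b c n" "i \<le> i'" "j \<le> j'" "k \<le> k'"
  shows "(i', j', k') \<in> power_exps a b c n"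
proof -
  from assms(1) obtain p q r s where
    "p + q + r + s = n" "p + a * q + r \<le> i" "p + b * r + s \<le> j" "p + q + c * s \<le> k"
    by (auto simp: power_exps_def)
  then have "p + q + r + s = n \<and> p + a * q + r \<le> i' \<and> p + b * r + s \<le> j' \<and> p + q + c * s \<le> k'"
    using assms(2-4) by linarith
  then show ?thesis unfolding power_exps_def by blast
qed

text \<open>
  Every monomial of \<open>I\<close> is a multiple of one of the four generators; which one is decided by the
  coordinate that vanishes, if any.
\<close>

lemma symb_exps_1_imp:
  assumes "a > 0" "b > 0" "c > 0" and x: "(i, j, k) \<in> symb_exps a b c 1"
  shows "(i, j, k) \<in> power_exps a b c 1"
proof -
  have x: "a \<le> i \<or> 1 \<le> j" "b \<le> j \<or> 1 \<le> k" "c \<le> k \<or> 1 \<le> i"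
    using x assms(1-3)
    by (auto simp: symb_exps_def Suc_le_eq div_greater_zero_iff)
  consider "j = 0" "a \<le> i" "1 \<le> k" | "k = 0" "1 \<le> i" "b \<le> j" | "i = 0" "1 \<le> j" "c \<le> k"
    | "1 \<le> i" "1 \<le> j" "1 \<le> k"
    using x assms(1-3) by linarith
  then show ?thesis
  proof cases
    case 1
    then show ?thesis by (intro power_exps_mono[OF generators_power_exps(2)]) auto
  next
    case 2
    then show ?thesis by (intro power_exps_mono[OF generators_power_exps(3)]) auto
  next
    case 3
    then show ?thesis by (intro power_exps_mono[OF generators_power_exps(4)]) auto
  next
    case 4
    then show ?thesis by (intro power_exps_mono[OF generators_power_exps(1)]) auto
  qed
qed

lemma power_exps_SucE:
  assumes "a > 0" "b > 0" "c > 0" and x: "(i, j, k) \<in> power_exps a b c (Suc n)"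
  obtains i' j' k' u v w where "(u, v, w) \<in> symb_exps a b c 1" "(i', j', k') \<in> power_exps a b c n"
    "i = i' + u" "j = j' + v" "k = k' + w"
proof -
  have "\<exists>u v w i' j' k'. (u, v, w) \<in> symb_exps a b c 1 \<and> (i', j', k') \<in> power_exps a b c n
    \<and> i = i' + u \<and> j = j' + v \<and> k = k' + w"
  proof -
    obtain p q r s where pqrs: "p + q + r + s = Suc n" "p + a * q + r \<le> i"
        "p + b * r + s \<le> j" "p + q + c * s \<le> k"
      using x by (auto simp: power_exps_def)
    have gen: ?thesis if "(u, v, w) \<in> symb_exps a b c 1" "p' + q' + r' + s' = n" "p' + a * q' + r' + u \<le> i"
        "p' + b * r' + s' + v \<le> j" "p' + q' + c * s' + w \<le> k" for u v w p' q' r' s'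
    proof -
      have "p' + q' + r' + s' = n \<and> p' + a * q' + r' \<le> i - u \<and> p' + b * r' + s' \<le> j - v
          \<and> p' + q' + c * s' \<le> k - w"
        using that by linarith
      then have "(i - u, j - v, k - w) \<in> power_exps a b c n" unfolding power_exps_def by blast
      moreover have "i = (i - u) + u" "j = (j - v) + v" "k = (k - w) + w" using that by linarith+
      ultimately show ?thesis using that(1) by blast
    qed
    consider p' where "p = Suc p'" | q' where "q = Suc q'" | r' where "r = Suc r'" | s' where "s = Suc s'"
      using pqrs(1) by (metis add_is_0 nat.distinct(1) not0_implies_Suc)
    then show ?thesis
    proof cases
      case 1
      have "(1, 1, 1) \<in> symb_exps a b c 1" using assms by (simp add: symb_exps_def)
      then show ?thesis by (rule gen[of 1 1 1 p' q r s]) (use 1 pqrs in \<open>auto simp: algebra_simps\<close>)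
    next
      case 2
      have "(a, 0, 1) \<in> symb_exps a b c 1" using assms by (simp add: symb_exps_def)
      then show ?thesis by (rule gen[of a 0 1 p q' r s]) (use 2 pqrs in \<open>auto simp: algebra_simps\<close>)
    next
      case 3
      have "(1, b, 0) \<in> symb_exps a b c 1" using assms by (simp add: symb_exps_def)
      then show ?thesis by (rule gen[of 1 b 0 p q r' s]) (use 3 pqrs in \<open>auto simp: algebra_simps\<close>)
    next
      case 4
      have "(0, 1, c) \<in> symb_exps a b c 1" using assms by (simp add: symb_exps_def)
      then show ?thesis by (rule gen[of 0 1 c p q r s']) (use 4 pqrs in \<open>auto simp: algebra_simps\<close>)
    qed
  qed
  then show thesis using that by blast
qed

lemma min_exps_rotate: "(i, j, k) \<in> min_exps a b c n \<longleftrightarrow> (j, k, i) \<in> min_exps b c a n"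
  unfolding min_exps_def using symb_exps_rotate by auto

lemma min_exps_below:
  assumes "x \<in> min_exps a b c n" "a > 0" "b > 0" "c > 0"
  shows "x \<in> {..a * n + n} \<times> {..b * n + n} \<times> {..c * n + n}"
proof -
  have *: "i \<le> a * n + n"
    if x: "(i, j, k) \<in> min_exps a b c n" and a: "a > 0" for a b c i j k
  proof (rule ccontr)
    assume "\<not> ?thesis"
    then have i: "i > a * n + n" by simp
    have "a * n div a \<le> (i - 1) div a" by (rule div_le_mono) (use i in linarith)
    then have "n \<le> (i - 1) div a" using a by simp
    moreover have "i - 1 \<ge> n" "i > 0" using i by auto
    ultimately show False
      using x by (auto simp: min_exps_def symb_exps_def)
  qed
  obtain i j k where x: "x = (i, j, k)" by (cases x)
  show ?thesis
    using *[of i j k a b c] *[of j k i b c a] *[of k i j c a b] assms unfolding x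
    by (simp add: min_exps_rotate[of i j k] min_exps_rotate[of j k i])
qed

lemma finite_min_exps:
  assumes "a > 0" "b > 0" "c > 0"
  shows "finite (min_exps a b c n)"
  by (rule finite_subset[of _ "{..a * n + n} \<times> {..b * n + n} \<times> {..c * n + n}"])
     (use min_exps_below assms in auto)

definition period :: "nat \<Rightarrow> nat \<Rightarrow> nat \<Rightarrow> nat"
  where "period a b c = a * b * c + 1"

text \<open>
  \<open>vertex a b c\<close> is \<open>N \<alpha>\<close> for \<open>N = period a b c\<close>, and \<open>vertex b c a\<close>, \<open>vertex c a b\<close> are \<open>N \<beta>\<close> and \<open>N \<gamma>\<close>.
  The form \<open>c - 1\<close> avoids a truncated difference of products.
\<close>

definition vertex :: "nat \<Rightarrow> nat \<Rightarrow> nat \<Rightarrow> nat"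
  where "vertex a b c = a * (b * (c - 1) + 1)"

lemma period_rotate: "period b c a = period a b c"
  by (simp add: period_def mult_ac)

text \<open>
  At the vertex the inequality is tight without rounding, since \<open>a\<close> divides \<open>vertex a b c\<close>.
\<close>

lemma vertex_edge:
  assumes "a > 0" "b > 0" "c > 0"
  shows "vertex a b c div a + vertex b c a = period a b c"
proof -
  obtain a' b' c' where "a = Suc a'" "b = Suc b'" "c = Suc c'"
    using assms by (metis gr0_implies_Suc)
  then have "vertex a b c div a = b * c' + 1"
    by (metis diff_Suc_1 nonzero_mult_div_cancel_left nat.distinct(1) vertex_def)
  then show ?thesis using \<open>a = Suc a'\<close> \<open>b = Suc b'\<close> \<open>c = Suc c'\<close>
    by (simp add: vertex_def period_def algebra_simps)
qed

lemma vertex_ge: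
  assumes "a > 0" "b > 0" "c > 0"
  shows "vertex a b c \<ge> a" "a = 1 \<Longrightarrow> vertex a b c \<ge> c"
proof -
  obtain a' b' c' where "a = Suc a'" "b = Suc b'" "c = Suc c'"
    using assms by (metis gr0_implies_Suc)
  then show "vertex a b c \<ge> a" "a = 1 \<Longrightarrow> vertex a b c \<ge> c" by (simp_all add: vertex_def)
qed

lemma div_vertex:
  assumes "a > 0"
  shows "(vertex a b c + i) div a = vertex a b c div a + i div a"
  using assms unfolding vertex_def by (metis div_mult_self4 less_irrefl nonzero_mult_div_cancel_left)

lemma div_pred: "(k::nat) div c \<le> (k - 1) div c + 1"
proof (cases "c = 0 \<or> k = 0")
  case False
  then obtain k' where k: "k = Suc k'" and c: "c > 0" by (metis gr0_conv_Suc neq0_conv)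
  have "Suc k' div c \<le> (k' + c) div c" using c by (intro div_le_mono) auto
  then show ?thesis using k c by simp
qed auto

lemma symb_exps_shift:
  assumes "a > 0" "b > 0" "c > 0"
  shows "(vertex a b c + i, vertex b c a + j, vertex c a b + k) \<in> symb_exps a b c (n + period a b c)
    \<longleftrightarrow> (i, j, k) \<in> symb_exps a b c n"
  using vertex_edge[of a b c] vertex_edge[of b c a] vertex_edge[of c a b]
        period_rotate[of a b c] period_rotate[of b c a] assms
        div_vertex[of a b c i] div_vertex[of b c a j] div_vertex[of c a b k]
  by (simp add: symb_exps_def; linarith)

lemma min_exps_first_zero:
  assumes "(0, j, k) \<in> min_exps a b c n" "a > 0" "b > 0" "c > 0"
  shows "k div c = n"
proof (rule ccontr)
  assume neq: "k div c \<noteq> n"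
  have x: "n \<le> j" "n \<le> j div b + k" "n \<le> k div c"
    using assms by (auto simp: min_exps_def symb_exps_def)
  with neq have k: "n < k div c" by simp
  have "(k - 1) div c + 1 \<ge> k div c" by (rule div_pred)
  then have "n \<le> (k - 1) div c" using k by linarith
  moreover have "n \<le> k - 1" 
    using calculation div_le_dividend order_trans by blast
  moreover have "k > 0" using k by (cases k) auto
  ultimately show False
    using assms(1) x by (auto simp: min_exps_def symb_exps_def)
qed


text \<open>
  A point with first coordinate \<open>0\<close> has no predecessor in that direction, but its translate by the
  vertex has one. That predecessor violates the third inequality as soon as this inequality is tight
  at the original point.
\<close>

lemma symb_exps_shift_zero:
  assumes "a > 0" "b > 0" "c > 0" and "k div c = n"
  shows "(vertex a b c - 1, j, vertex c a b + k) \<notin> symb_exps a b c (n + period a b c)"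
proof -
  have "vertex c a b div c + vertex a b c = period a b c"
    using vertex_edge[of c a b] period_rotate assms(1-3) by metis
  moreover have "vertex a b c > 0" using vertex_ge(1)[of a b c] assms by linarith
  ultimately have "(vertex c a b + k) div c + (vertex a b c - 1) < n + period a b c"
    using assms(4) div_vertex[of c a b k] assms(3) by linarith
  then show ?thesis by (simp add: symb_exps_def)
qed

lemma min_exps_shift:
  assumes "a > 0" "b > 0" "c > 0"
  shows "(vertex a b c + i, vertex b c a + j, vertex c a b + k) \<in> min_exps a b c (n + period a b c)
    \<longleftrightarrow> (i, j, k) \<in> min_exps a b c n"
proof -
  let ?S = "symb_exps a b c n" and ?S' = "symb_exps a b c (n + period a b c)"
  let ?A = "vertex a b c" and ?B = "vertex b c a" and ?C = "vertex c a b"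
  note shift = symb_exps_shift[OF assms]
  have pos: "?A > 0" "?B > 0" "?C > 0"
    using vertex_ge(1)[of a b c] vertex_ge(1)[of b c a] vertex_ge(1)[of c a b] assms by linarith+
  have s1: "(?A + i - 1, ?B + j, ?C + k) \<in> ?S' \<longleftrightarrow> (i - 1, j, k) \<in> ?S" if "i > 0"
    using shift[of "i - 1" j k n] that by simp
  have s2: "(?A + i, ?B + j - 1, ?C + k) \<in> ?S' \<longleftrightarrow> (i, j - 1, k) \<in> ?S" if "j > 0"
    using shift[of i "j - 1" k n] that by simp
  have s3: "(?A + i, ?B + j, ?C + k - 1) \<in> ?S' \<longleftrightarrow> (i, j, k - 1) \<in> ?S" if "k > 0"
    using shift[of i j "k - 1" n] that by simp
  show ?thesis
  proof
    assume x: "(?A + i, ?B + j, ?C + k) \<in> min_exps a b c (n + period a b c)"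
    show "(i, j, k) \<in> min_exps a b c n"
      using x s1 s2 s3 shift[of i j k n] pos by (simp add: min_exps_def)
  next
    assume x: "(i, j, k) \<in> min_exps a b c n"
    have y: "(j, k, i) \<in> min_exps b c a n" "(k, i, j) \<in> min_exps c a b n"
      using x min_exps_rotate[of i j k] min_exps_rotate[of j k i] by auto
    have z1: "(?A + 0 - 1, ?B + j, ?C + k) \<notin> ?S'" if "i = 0"
      using symb_exps_shift_zero[OF assms, of k n] min_exps_first_zero[of j k a b c n] x assms that
      by simp
    have z2: "(?A + i, ?B + 0 - 1, ?C + k) \<notin> ?S'" if "j = 0"
      using symb_exps_shift_zero[of b c a i n] min_exps_first_zero[of k i b c a n] y assms that
      by (simp add: symb_exps_rotate[of _ _ _ a b c] period_rotate)
    have z3: "(?A + i, ?B + j, ?C + 0 - 1) \<notin> ?S'" if "k = 0"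
      using symb_exps_shift_zero[of c a b j n] min_exps_first_zero[of i j c a b n] y assms that
      by (simp add: symb_exps_rotate[of _ _ _ a b c] symb_exps_rotate[of _ _ _ b c a] period_rotate)
    have "(?A + i - 1, ?B + j, ?C + k) \<notin> ?S'"
      using x s1 z1 by (cases "i = 0") (auto simp: min_exps_def)
    moreover have "(?A + i, ?B + j - 1, ?C + k) \<notin> ?S'"
      using x s2 z2 by (cases "j = 0") (auto simp: min_exps_def)
    moreover have "(?A + i, ?B + j, ?C + k - 1) \<notin> ?S'"
      using x s3 z3 by (cases "k = 0") (auto simp: min_exps_def)
    ultimately show "(?A + i, ?B + j, ?C + k) \<in> min_exps a b c (n + period a b c)"
      using x shift[of i j k n] by (simp add: min_exps_def)
  qed
qed

text \<open>
  Below the vertex the first and the third inequality already imply the second one, so that the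
  solutions with first coordinate \<open>i\<close> form a translated quadrant, with one corner.
\<close>

lemma min_exps_low:
  assumes "a > 0" "b > 0" "c > 0" and i: "i < vertex a b c" and n: "period a b c \<le> n"
  shows "(i, j, k) \<in> min_exps a b c n \<longleftrightarrow> j = n - i div a \<and> k = c * (n - i)"
proof -
  let ?j = "n - i div a" and ?k = "c * (n - i)"
  have ia: "i div a \<le> vertex a b c div a" using i by (intro div_le_mono) auto
  have e1: "vertex a b c div a + vertex b c a = period a b c" using assms vertex_edge by blast
  have e2: "vertex b c a div b + vertex c a b = period a b c"
    using assms vertex_edge period_rotate by metis
  have e3: "vertex c a b div c + vertex a b c = period a b c"
    using assms vertex_edge period_rotate by metis
  have in_n: "i < n" using i e3 n by linarith
  have k_iff: "n \<le> k div c + i \<longleftrightarrow> ?k \<le> k" for k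
  proof -
    have "n \<le> k div c + i \<longleftrightarrow> n - i \<le> k div c" by linarith
    also have "\<dots> \<longleftrightarrow> ?k \<le> k"
      using assms(3) by (simp add: less_eq_div_iff_mult_less_eq mult.commute)
    finally show ?thesis .
  qed
  have j_iff: "n \<le> i div a + j \<longleftrightarrow> ?j \<le> j" for j by linarith
  have mid: "n \<le> j div b + k" if "?j \<le> j" "?k \<le> k" for j k
  proof -
    obtain d where d: "n = period a b c + d" using n le_Suc_ex by blast
    have "vertex b c a \<le> j" using that(1) ia e1 n by linarith
    then have "vertex b c a div b \<le> j div b" by (rule div_le_mono)
    moreover have "c * (vertex c a b div c + d) \<le> c * (n - i)"
      using d e3 i by (intro mult_left_mono) auto
    moreover have "c * (vertex c a b div c) = vertex c a b" by (simp add: vertex_def)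
    moreover have "d \<le> c * d" using assms(3) by simp
    ultimately show ?thesis using that(2) d e2 unfolding distrib_left by linarith
  qed
  have S: "(i, j, k) \<in> symb_exps a b c n \<longleftrightarrow> ?j \<le> j \<and> ?k \<le> k" for j k
    using k_iff[of k] j_iff[of j] mid[of j k] by (auto simp: symb_exps_def)
  have below: "(i - 1, ?j, ?k) \<notin> symb_exps a b c n" if "i > 0"
  proof -
    have "(c * (n - i)) div c + (i - 1) < n" using that in_n assms(3) by simp
    then show ?thesis unfolding symb_exps_def by auto
  qed
  show ?thesis
  proof
    assume x: "(i, j, k) \<in> min_exps a b c n"
    then have "?j \<le> j" "?k \<le> k" using S by (auto simp: min_exps_def)
    moreover have "\<not> ?j < j" using x S[of "j - 1" k] calculation by (auto simp: min_exps_def)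
    moreover have "\<not> ?k < k" using x S[of j "k - 1"] calculation by (auto simp: min_exps_def)
    ultimately show "j = ?j \<and> k = ?k" by auto
  next
    assume x: "j = ?j \<and> k = ?k"
    have nb: "(i, ?j - 1, ?k) \<notin> symb_exps a b c n" if "?j > 0" using that by (simp only: S) linarith
    have nc: "(i, ?j, ?k - 1) \<notin> symb_exps a b c n" if "?k > 0" using that by (simp only: S) linarith
    show "(i, j, k) \<in> min_exps a b c n"
      unfolding min_exps_def using x S[of ?j ?k] below nb nc by blast
  qed
qed

text \<open>
  The \<open>x\<close>-exponent \<open>i\<close> admits at most \<open>i\<close> factors other than \<open>yz\<^sup>c\<close>. The \<open>n - i\<close> factors \<open>yz\<^sup>c\<close> use up the
  whole \<open>z\<close>-exponent, so the others are \<open>xy\<^sup>b\<close>; these fit into the \<open>y\<close>-exponent only if there are none or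
  \<open>b = 1\<close> and \<open>i div a = 0\<close>.
\<close>

lemma low_power_exps:
  assumes "a > 0" "b > 0" "c > 0" and "i < n" and ia: "i div a \<le> n"
  shows "(i, n - i div a, c * (n - i)) \<in> power_exps a b c n \<longleftrightarrow> i = 0 \<or> (b = 1 \<and> i < a)"
proof
  assume "(i, n - i div a, c * (n - i)) \<in> power_exps a b c n"
  then obtain p q r s where pqrs: "p + q + r + s = n" "p + a * q + r \<le> i"
      "p + b * r + s \<le> n - i div a" "p + q + c * s \<le> c * (n - i)"
    by (auto simp: power_exps_def)
  have "q \<le> a * q" "r \<le> b * r" using assms by auto
  have "n - i \<le> s" using pqrs \<open>q \<le> a * q\<close> by linarith
  then have "c * (n - i) \<le> c * s" by simp
  then have z: "p = 0" "q = 0" and "c * s \<le> c * (n - i)" using pqrs(4) by linarith+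
  then have "s \<le> n - i" using assms by simp
  then have ir: "i = r" using pqrs z \<open>i < n\<close> by linarith
  then have "b * r + i div a \<le> r" using pqrs z ia by linarith
  then have "b * r \<le> r" "i div a = 0" using \<open>r \<le> b * r\<close> by linarith+
  show "i = 0 \<or> (b = 1 \<and> i < a)"
  proof (cases "r = 0")
    case False
    then have "b = 1" using \<open>b * r \<le> r\<close> assms(2) by simp
    then show ?thesis using \<open>i div a = 0\<close> assms(1) by (simp add: div_eq_0_iff)
  qed (use ir in simp)
next
  assume "i = 0 \<or> (b = 1 \<and> i < a)"
  then have "0 + 0 + i + (n - i) = n \<and> 0 + a * 0 + i \<le> i \<and> 0 + b * i + (n - i) \<le> n - i div a
      \<and> 0 + 0 + c * (n - i) \<le> c * (n - i)"
    using assms by auto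
  then show "(i, n - i div a, c * (n - i)) \<in> power_exps a b c n" unfolding power_exps_def by blast
qed

text \<open>
  Tightness of the first inequality forces \<open>p + r < a\<close>, tightness of the third one forces \<open>p + q < c\<close>
  and \<open>q = 0\<close> unless \<open>a = 1\<close>. Almost all factors are then \<open>yz\<^sup>c\<close>, and the \<open>x\<close>-exponent stays small.
\<close>

lemma tight_power_exps_low:
  assumes "a > 0" "b > 0" "c > 0" and x: "(i, j, k) \<in> power_exps a b c n"
    and t1: "i div a + j = n" and t3: "k div c + i = n"
  shows "i < vertex a b c"
proof -
  from x obtain p q r s where pqrs: "p + q + r + s = n" "p + a * q + r \<le> i"
      "p + b * r + s \<le> j" "p + q + c * s \<le> k"
    by (auto simp: power_exps_def)
  have "q \<le> a * q" "r \<le> b * r" using assms by auto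
  have "(a * q + (p + r)) div a \<le> i div a" by (rule div_le_mono) (use pqrs in linarith)
  then have "q + (p + r) div a \<le> i div a" using assms(1) by simp
  then have "(p + r) div a = 0" using t1 pqrs \<open>r \<le> b * r\<close> by linarith
  then have pr: "p + r < a" using assms(1) by (simp add: div_eq_0_iff)
  have "(c * s + (p + q)) div c \<le> k div c" by (rule div_le_mono) (use pqrs in linarith)
  then have k: "s + (p + q) div c \<le> k div c" using assms(3) by simp
  then have z: "(p + q) div c = 0" "a * q \<le> q" using t3 pqrs \<open>q \<le> a * q\<close> by linarith+
  then have pq: "p + q < c" using assms(3) by (simp add: div_eq_0_iff)
  have i: "i \<le> p + q + r" using k t3 pqrs by linarith
  show ?thesis
  proof (cases "q = 0")
    case True
    then show ?thesis using i pr vertex_ge(1)[of a b c] assms by linarith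
  next
    case False
    then have "a = 1" using z assms(1) by simp
    then show ?thesis using i pq pr vertex_ge(2)[of a b c] assms by linarith
  qed
qed

text \<open>
  No coordinate can be decreased, and each decrease violates one of the two inequalities in which the
  coordinate occurs; so at most one of the three inequalities fails to be tight.
\<close>

lemma min_exps_high:
  assumes "a > 0" "b > 0" "c > 0" and x: "(i, j, k) \<in> min_exps a b c n"
    and ge: "vertex a b c \<le> i" "vertex b c a \<le> j" "vertex c a b \<le> k"
  shows "(i, j, k) \<notin> power_exps a b c n"
proof
  assume T: "(i, j, k) \<in> power_exps a b c n"
  let ?t1 = "i div a + j = n" and ?t2 = "j div b + k = n" and ?t3 = "k div c + i = n"
  have pos: "i > 0" "j > 0" "k > 0"
    using ge vertex_ge(1)[of a b c] vertex_ge(1)[of b c a] vertex_ge(1)[of c a b] assms by linarith+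
  have S: "n \<le> i div a + j" "n \<le> j div b + k" "n \<le> k div c + i"
    using x by (auto simp: min_exps_def symb_exps_def)
  have "?t1 \<or> ?t3" using x pos S div_pred[of i a] by (auto simp: min_exps_def symb_exps_def)
  moreover have "?t1 \<or> ?t2" using x pos S div_pred[of j b] by (auto simp: min_exps_def symb_exps_def)
  moreover have "?t2 \<or> ?t3" using x pos S div_pred[of k c] by (auto simp: min_exps_def symb_exps_def)
  moreover have "\<not> (?t1 \<and> ?t3)" using tight_power_exps_low[OF assms(1-3) T] ge by linarith
  moreover have "\<not> (?t2 \<and> ?t1)"
    using tight_power_exps_low[of b c a j k i n] assms T ge power_exps_rotate by fastforce
  moreover have "\<not> (?t3 \<and> ?t2)"
    using tight_power_exps_low[of c a b k i j n] assms T ge power_exps_rotate[of i j k] power_exps_rotate[of j k i] by fastforce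
  ultimately show False by blast
qed


definition sdef_exps :: "nat \<Rightarrow> nat \<Rightarrow> nat \<Rightarrow> nat \<Rightarrow> (nat \<times> nat \<times> nat) set"
  where "sdef_exps a b c n = min_exps a b c n - power_exps a b c n"

text \<open>
  The number of minimal exponents on one edge that do not belong to the ordinary power.
\<close>

definition edge_card :: "nat \<Rightarrow> nat \<Rightarrow> nat \<Rightarrow> nat"
  where "edge_card a b c = card {i. i < vertex a b c \<and> \<not> (i = 0 \<or> (b = 1 \<and> i < a))}"

lemma sdef_exps_rotate: "(i, j, k) \<in> sdef_exps a b c n \<longleftrightarrow> (j, k, i) \<in> sdef_exps b c a n"
  unfolding sdef_exps_def using min_exps_rotate[of i j k] power_exps_rotate[of i j k] by simp

lemma card_low:
  assumes "a > 0" "b > 0" "c > 0" and n: "period a b c \<le> n"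
  shows "card {(i, j, k). (i, j, k) \<in> min_exps a b c n \<and> i < vertex a b c} = vertex a b c"
    and "card {(i, j, k). (i, j, k) \<in> sdef_exps a b c n \<and> i < vertex a b c} = edge_card a b c"
    and "(i, j, k) \<in> min_exps a b c n \<Longrightarrow> i < vertex a b c \<Longrightarrow> vertex b c a \<le> j \<and> vertex c a b \<le> k"
proof -
  let ?f = "\<lambda>i. (i, n - i div a, c * (n - i))"
  have inj: "inj_on ?f X" for X by (auto intro: inj_onI)
  have e1: "vertex a b c div a + vertex b c a = period a b c" using assms vertex_edge by blast
  have e3: "vertex c a b div c + vertex a b c = period a b c"
    using assms vertex_edge period_rotate by metis
  have ia: "i div a \<le> vertex a b c div a" if "i < vertex a b c" for i
    using that by (intro div_le_mono) auto
  have "{(i, j, k). (i, j, k) \<in> min_exps a b c n \<and> i < vertex a b c} = ?f ` {..<vertex a b c}"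
    using min_exps_low[OF assms(1-3) _ n] by auto
  then show "card {(i, j, k). (i, j, k) \<in> min_exps a b c n \<and> i < vertex a b c} = vertex a b c"
    using inj by (simp add: card_image)
  have "(i, n - i div a, c * (n - i)) \<in> sdef_exps a b c n \<longleftrightarrow> \<not> (i = 0 \<or> (b = 1 \<and> i < a))"
    if "i < vertex a b c" for i
  proof -
    have "i < n" "i div a \<le> n" using that e3 e1 n ia[OF that] by linarith+
    then show ?thesis
      using min_exps_low[OF assms(1-3) that n] low_power_exps[OF assms(1-3), of i n]
      by (simp add: sdef_exps_def)
  qed
  then have "{(i, j, k). (i, j, k) \<in> sdef_exps a b c n \<and> i < vertex a b c}
      = ?f ` {i. i < vertex a b c \<and> \<not> (i = 0 \<or> (b = 1 \<and> i < a))}"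
    using min_exps_low[OF assms(1-3) _ n] by (auto simp: sdef_exps_def)
  then show "card {(i, j, k). (i, j, k) \<in> sdef_exps a b c n \<and> i < vertex a b c} = edge_card a b c"
    using inj by (simp add: card_image edge_card_def)
  show "vertex b c a \<le> j \<and> vertex c a b \<le> k" 
    if x: "(i, j, k) \<in> min_exps a b c n" and i: "i < vertex a b c"
  proof -
    have jk: "j = n - i div a" "k = c * (n - i)" using min_exps_low[OF assms(1-3) i n] x by auto
    have "vertex b c a \<le> j" using jk ia[OF i] e1 n by linarith
    moreover have "c * (vertex c a b div c) \<le> c * (n - i)" using e3 n i by (intro mult_left_mono) auto
    moreover have "c * (vertex c a b div c) = vertex c a b" by (simp add: vertex_def)
    ultimately show ?thesis using jk by simp
  qed
qed

text \<open>
  The conditions say that the three slabs outside the octant at \<open>(A, B, C)\<close> are disjoint.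
\<close>

lemma card_split:
  fixes P :: "(nat \<times> nat \<times> nat) set"
  assumes "finite P"
    and "\<And>i j k. (i, j, k) \<in> P \<Longrightarrow> i < A \<Longrightarrow> B \<le> j \<and> C \<le> k"
    and "\<And>i j k. (i, j, k) \<in> P \<Longrightarrow> j < B \<Longrightarrow> C \<le> k \<and> A \<le> i"
  shows "card P = card {(i, j, k). (A + i, B + j, C + k) \<in> P}
    + card {(i, j, k). (i, j, k) \<in> P \<and> i < A} + card {(i, j, k). (i, j, k) \<in> P \<and> j < B}
    + card {(i, j, k). (i, j, k) \<in> P \<and> k < C}"
proof -
  let ?X = "{(i, j, k). (i, j, k) \<in> P \<and> i < A}" and ?Y = "{(i, j, k). (i, j, k) \<in> P \<and> j < B}"
    and ?Z = "{(i, j, k). (i, j, k) \<in> P \<and> k < C}"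
  let ?H = "{(i, j, k). (A + i, B + j, C + k) \<in> P}"
  let ?s = "\<lambda>(i, j, k). (A + i, B + j, C + k)"
  have fin: "finite ?X" "finite ?Y" "finite ?Z"
    by (rule finite_subset[OF _ assms(1)]; auto)+
  have "inj_on ?s ?H" by (auto intro!: inj_onI)
  have fH: "finite (?s ` ?H)" by (rule finite_subset[OF _ assms(1)]) auto
  have P: "P = ?s ` ?H \<union> (?X \<union> (?Y \<union> ?Z))"
  proof (intro equalityI subsetI)
    fix x assume x: "x \<in> P"
    obtain i j k where ijk: "x = (i, j, k)" by (cases x)
    show "x \<in> ?s ` ?H \<union> (?X \<union> (?Y \<union> ?Z))"
    proof (cases "i < A \<or> j < B \<or> k < C")
      case False
      then have "x = ?s (i - A, j - B, k - C)" "(i - A, j - B, k - C) \<in> ?H"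
        using x ijk by auto
      then show ?thesis by blast
    qed (use x ijk in auto)
  qed auto
  have d: "?s ` ?H \<inter> (?X \<union> (?Y \<union> ?Z)) = {}" "?X \<inter> (?Y \<union> ?Z) = {}" "?Y \<inter> ?Z = {}"
    using assms(2,3) by force+
  have "card P = card (?s ` ?H) + (card ?X + (card ?Y + card ?Z))"
    by (subst P) (use fin fH d in \<open>simp add: card_Un_disjoint\<close>)
  then show ?thesis using card_image[OF \<open>inj_on ?s ?H\<close>] by simp
qed

lemma card_rotate:
  "card {(i, j, k). Q j k i} = card {(i, j, k). Q i j k}"
  "card {(i, j, k). Q k i j} = card {(i, j, k). Q i j k}"
proof -
  have "bij_betw (\<lambda>(i, j, k). (k, i, j)) {(i, j, k). R i j k} {(i, j, k). R j k i}" for R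
    by (rule bij_betw_byWitness[where f' = "\<lambda>(i, j, k). (j, k, i)"]) auto
  then have *: "card {(i, j, k). R j k i} = card {(i, j, k). R i j k}" for R
    using bij_betw_same_card by metis
  show "card {(i, j, k). Q j k i} = card {(i, j, k). Q i j k}" by (rule *)
  show "card {(i, j, k). Q k i j} = card {(i, j, k). Q i j k}"
    using *[of "\<lambda>i j k. Q k i j"] by simp
qed

lemma card_min_exps_step:
  assumes "a > 0" "b > 0" "c > 0"
  shows "card (min_exps a b c (n + period a b c)) = card (min_exps a b c n)
      + (vertex a b c + vertex b c a + vertex c a b)" (is ?m)
    and "card (sdef_exps a b c (n + period a b c)) = card (min_exps a b c n)
      + (edge_card a b c + edge_card b c a + edge_card c a b)" (is ?d)
proof -
  let ?n = "n + period a b c"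
  have p: "period a b c \<le> ?n" "period b c a \<le> ?n" "period c a b \<le> ?n"
    using period_rotate[of a b c] period_rotate[of b c a] by simp_all
  note l1 = card_low[OF assms(1,2,3) p(1)]
    and l2 = card_low[OF assms(2,3,1) p(2)]
    and l3 = card_low[OF assms(3,1,2) p(3)]
  have fin: "finite (min_exps a b c ?n)" by (rule finite_min_exps[OF assms])
  then have fin': "finite (sdef_exps a b c ?n)" by (simp add: sdef_exps_def)
  have jB: "vertex c a b \<le> k \<and> vertex a b c \<le> i"
    if "(i, j, k) \<in> min_exps a b c ?n" "j < vertex b c a" for i j k
    using l2(3)[of j k i] that min_exps_rotate[of i j k] by simp
  have m2: "card {(i, j, k). (i, j, k) \<in> min_exps a b c ?n \<and> j < vertex b c a} = vertex b c a"
    using l2(1) card_rotate(1)[of "\<lambda>i j k. (i, j, k) \<in> min_exps b c a ?n \<and> i < vertex b c a"]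
    by (simp add: min_exps_rotate[of _ _ _ a b c])
  have m3: "card {(i, j, k). (i, j, k) \<in> min_exps a b c ?n \<and> k < vertex c a b} = vertex c a b"
    using l3(1) card_rotate(2)[of "\<lambda>i j k. (i, j, k) \<in> min_exps c a b ?n \<and> i < vertex c a b"]
    by (simp add: min_exps_rotate[of _ _ _ a b c] min_exps_rotate[of _ _ _ b c a])
  have d2: "card {(i, j, k). (i, j, k) \<in> sdef_exps a b c ?n \<and> j < vertex b c a} = edge_card b c a"
    using l2(2) card_rotate(1)[of "\<lambda>i j k. (i, j, k) \<in> sdef_exps b c a ?n \<and> i < vertex b c a"]
    by (simp add: sdef_exps_rotate[of _ _ _ a b c])
  have d3: "card {(i, j, k). (i, j, k) \<in> sdef_exps a b c ?n \<and> k < vertex c a b} = edge_card c a b"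
    using l3(2) card_rotate(2)[of "\<lambda>i j k. (i, j, k) \<in> sdef_exps c a b ?n \<and> i < vertex c a b"]
    by (simp add: sdef_exps_rotate[of _ _ _ a b c] sdef_exps_rotate[of _ _ _ b c a])
  show ?m
    using card_split[OF fin l1(3) jB] l1(1) m2 m3 min_exps_shift[OF assms] by simp
  have sub: "(i, j, k) \<in> min_exps a b c ?n" if "(i, j, k) \<in> sdef_exps a b c ?n" for i j k
    using that by (simp add: sdef_exps_def)
  have "(vertex a b c + i, vertex b c a + j, vertex c a b + k) \<in> sdef_exps a b c ?n
      \<longleftrightarrow> (i, j, k) \<in> min_exps a b c n" for i j k
    using min_exps_shift[OF assms, of i j k n]
      min_exps_high[OF assms, of "vertex a b c + i" "vertex b c a + j" "vertex c a b + k" ?n]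
    by (auto simp: sdef_exps_def)
  then show ?d
    using card_split[OF fin' l1(3)[OF sub] jB[OF sub]] l1(2) d2 d3 by simp
qed

lemma card_min_exps:
  assumes "a > 0" "b > 0" "c > 0"
  shows "card (min_exps a b c n) = card (min_exps a b c (n mod period a b c))
      + n div period a b c * (vertex a b c + vertex b c a + vertex c a b)"
proof -
  have "card (min_exps a b c (r + q * period a b c)) = card (min_exps a b c r)
      + q * (vertex a b c + vertex b c a + vertex c a b)" for q r
  proof (induction q)
    case (Suc q)
    then show ?case
      using card_min_exps_step(1)[OF assms, of "r + q * period a b c"] by (simp add: add_ac)
  qed simp
  from this[of "n mod period a b c" "n div period a b c"] show ?thesis by simp
qed

lemma card_sdef_exps:
  assumes "a > 0" "b > 0" "c > 0"
  obtains h :: "nat \<Rightarrow> real" where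
    "\<And>n. n \<ge> period a b c \<Longrightarrow> real (card (sdef_exps a b c n))
      = h (n mod period a b c)
        + real (vertex a b c + vertex b c a + vertex c a b) / real (period a b c) * real n"
proof
  fix n assume "n \<ge> period a b c"
  let ?N = "period a b c" and ?s = "vertex a b c + vertex b c a + vertex c a b"
    and ?e = "edge_card a b c + edge_card b c a + edge_card c a b"
  obtain m where n: "n = m + ?N" using \<open>n \<ge> ?N\<close> le_Suc_ex by (metis add.commute)
  have N: "real ?N > 0" unfolding period_def of_nat_0_less_iff by simp
  have "real m = real (m div ?N) * real ?N + real (m mod ?N)"
    by (metis div_mult_mod_eq of_nat_add of_nat_mult)
  then have q: "real (m div ?N) = (real n - real ?N - real (m mod ?N)) / real ?N"
    using N n by (simp add: field_simps)
  have "real (card (sdef_exps a b c n)) = real (card (min_exps a b c (m mod ?N)))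
      + real (m div ?N) * real ?s + real ?e"
    using card_min_exps[OF assms, of m] card_min_exps_step(2)[OF assms, of m] n by simp
  moreover have "m mod ?N = n mod ?N" using n by simp
  moreover have "(real n - real ?N - real (m mod ?N)) / real ?N * real ?s
      = real ?s / real ?N * real n - (real ?N + real (m mod ?N)) * real ?s / real ?N"
    using N by (simp add: field_simps)
  ultimately show "real (card (sdef_exps a b c n))
      = (\<lambda>r. real (card (min_exps a b c r)) + real ?e - (real ?N + real r) * real ?s / real ?N) (n mod ?N)
        + real ?s / real ?N * real n"
    using q by (simp del: of_nat_add)
qed

section \<open>Monomial ideals\<close>

lemma three_cases:
  fixes i :: 3
  obtains "i = 0" | "i = 1" | "i = 2"
proof -
  have "i \<in> {0, 1, 2}"
  proof (cases i rule: bit1_cases)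
    case (of_int z)
    then have "z = 0 \<or> z = 1 \<or> z = 2" by auto
    then show ?thesis using of_int by auto
  qed
  then show thesis using that by blast
qed

lemma three_all: "(\<forall>i::3. P i) \<longleftrightarrow> P 0 \<and> P 1 \<and> P 2"
  by (metis three_cases)

lemma three_wrap: "(3::3) = 0" "(4::3) = 1" "(5::3) = 2"
  by simp_all

lemma three_arith:
  fixes e :: 3
  shows "e + 1 + 1 = e + 2" "e + 1 + 2 = e" "e + 2 + 1 = e" "e + 2 + 2 = e + 1"
  by (rule three_cases[of e]; simp)+

lemma three_neq:
  fixes e :: 3
  shows "e + 1 \<noteq> e" "e + 2 \<noteq> e" "e + 1 \<noteq> e + 2"
  by (rule three_cases[of e]; simp)+

lemma three_all_rotate:
  fixes e :: 3
  shows "(\<forall>i. P i) \<longleftrightarrow> P (e + 1) \<and> P (e + 2) \<and> P e"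
  by (rule three_cases[of e]) (auto simp: three_all three_wrap)

lemma three_less: "(i::3) < 1 \<longleftrightarrow> i = 0" "\<not> (i::3) < 0"
proof -
  note rep = less_bit1_def bit1.Rep_0 bit1.Rep_1 bit1.Rep_numeral
  have "(0::3) < 1" "\<not> (1::3) < 0" "\<not> (2::3) < 0" "\<not> (2::3) < 1" by (simp_all add: rep)
  moreover have "(1::3) \<noteq> 0" "(2::3) \<noteq> 0" by simp_all
  ultimately show "i < 1 \<longleftrightarrow> i = 0" "\<not> i < 0"
    by (metis less_irrefl three_cases)+
qed

abbreviation keys :: "('x \<Rightarrow>\<^sub>0 'y::zero) \<Rightarrow> 'x set" where "keys \<equiv> Poly_Mapping.keys"
abbreviation lookup :: "('x \<Rightarrow>\<^sub>0 'y::zero) \<Rightarrow> 'x \<Rightarrow> 'y" where "lookup \<equiv> Poly_Mapping.lookup"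

text \<open>
  Closure under negation comes for free from multiplication by \<open>\<ominus>\<one>\<close>.
\<close>

lemma ideal_criterion:
  assumes "ring R" "J \<subseteq> carrier R" "\<zero>\<^bsub>R\<^esub> \<in> J"
    and "\<And>x y. x \<in> J \<Longrightarrow> y \<in> J \<Longrightarrow> x \<oplus>\<^bsub>R\<^esub> y \<in> J"
    and "\<And>r x. r \<in> carrier R \<Longrightarrow> x \<in> J \<Longrightarrow> r \<otimes>\<^bsub>R\<^esub> x \<in> J"
    and "\<And>r x. r \<in> carrier R \<Longrightarrow> x \<in> J \<Longrightarrow> x \<otimes>\<^bsub>R\<^esub> r \<in> J"
  shows "ideal J R"
proof -
  interpret ring R by fact
  have "\<ominus>\<^bsub>R\<^esub> x \<in> J" if "x \<in> J" for x
  proof -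
    have "\<ominus>\<^bsub>R\<^esub> x = (\<ominus>\<^bsub>R\<^esub> \<one>\<^bsub>R\<^esub>) \<otimes>\<^bsub>R\<^esub> x" using that assms(2) by (simp add: l_minus subset_iff)
    then show ?thesis using assms(5)[of "\<ominus>\<^bsub>R\<^esub> \<one>\<^bsub>R\<^esub>" x] that by simp
  qed
  then have "subgroup J (add_monoid R)"
    using assms by (intro add.subgroupI) (auto simp: a_inv_def)
  then show ?thesis using assms by (intro idealI) auto
qed

lemma ideal_class_ring_iff:
  fixes J :: "'r::comm_ring_1 set"
  shows "ideal J class_ring \<longleftrightarrow>
    0 \<in> J \<and> (\<forall>x\<in>J. \<forall>y\<in>J. x + y \<in> J) \<and> (\<forall>r. \<forall>x\<in>J. r * x \<in> J)"
proof
  assume "ideal J class_ring"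
  then interpret ideal J "class_ring :: 'r ring" .
  show "0 \<in> J \<and> (\<forall>x\<in>J. \<forall>y\<in>J. x + y \<in> J) \<and> (\<forall>r. \<forall>x\<in>J. r * x \<in> J)"
    using additive_subgroup.zero_closed[OF additive_subgroup_axioms] a_closed I_l_closed by auto
next
  assume "0 \<in> J \<and> (\<forall>x\<in>J. \<forall>y\<in>J. x + y \<in> J) \<and> (\<forall>r. \<forall>x\<in>J. r * x \<in> J)"
  then show "ideal J class_ring"
    by (intro ideal_criterion) (auto simp: class_ring.ring_axioms mult.commute)
qed

definition upset :: "'m::monoid_add set \<Rightarrow> bool"
  where "upset U \<longleftrightarrow> (\<forall>m\<in>U. \<forall>d. m + d \<in> U)"

definition mono_ideal :: "(3 \<Rightarrow>\<^sub>0 nat) set \<Rightarrow> 'k::field poly3 set"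
  where "mono_ideal U = {f. keys f \<subseteq> U}"

lemma keys_mult_upset:
  fixes f g :: "'k::field poly3"
  assumes "upset U" "keys f \<subseteq> U"
  shows "keys (g * f) \<subseteq> U"
proof -
  have "keys (g * f) \<subseteq> {x + y |x y. x \<in> keys g \<and> y \<in> keys f}" by (rule keys_mult)
  also have "\<dots> \<subseteq> U" using assms unfolding upset_def by (clarsimp simp: subset_iff) (metis add.commute)
  finally show ?thesis .
qed

lemma ideal_mono_ideal: "upset U \<Longrightarrow> ideal (mono_ideal U) class_ring"
  unfolding ideal_class_ring_iff mono_ideal_def
  using keys_mult_upset by (auto dest!: subsetD[OF keys_add])

lemma poly_mapping_sum_single: "f = (\<Sum>m\<in>keys f. Poly_Mapping.single m (lookup f m))"
  by (rule poly_mapping_eqI)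
     (auto simp: lookup_sum lookup_single when_def in_keys_iff sum.delta)

lemma sum_closed_ideal:
  fixes J :: "'r::comm_ring_1 set"
  assumes "ideal J class_ring" "\<And>x. x \<in> A \<Longrightarrow> g x \<in> J"
  shows "sum g A \<in> J"
  using assms(2) assms(1) by (induction A rule: infinite_finite_induct) (auto simp: ideal_class_ring_iff)

lemma mono_ideal_subset:
  assumes "ideal J class_ring" and "\<And>m. m \<in> U \<Longrightarrow> Poly_Mapping.single m 1 \<in> J"
  shows "mono_ideal U \<subseteq> (J :: 'k::field poly3 set)"
proof
  fix f :: "'k poly3" assume f: "f \<in> mono_ideal U"
  have "Poly_Mapping.single m c \<in> J" if "m \<in> U" for m c
  proof -
    have "Poly_Mapping.single m c = Poly_Mapping.single 0 c * Poly_Mapping.single m 1"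
      by (simp add: mult_single)
    then show ?thesis using assms that by (auto simp: ideal_class_ring_iff)
  qed
  then have "(\<Sum>m\<in>keys f. Poly_Mapping.single m (lookup f m)) \<in> J"
    using f by (intro sum_closed_ideal[OF assms(1)]) (auto simp: mono_ideal_def)
  then show "f \<in> J" using poly_mapping_sum_single[of f] by simp
qed

lemma genideal_monomials:
  "Idl\<^bsub>class_ring\<^esub> ((\<lambda>m. Poly_Mapping.single m 1) ` G)
    = (mono_ideal {m. \<exists>g\<in>G. \<exists>d. m = g + d} :: 'k::field poly3 set)" (is "Idl\<^bsub>_\<^esub> ?M = mono_ideal ?U")
proof
  have up: "upset ?U" unfolding upset_def by (clarsimp simp: add.assoc) blast
  have "?M \<subseteq> mono_ideal ?U"
  proof
    fix f :: "'k poly3" assume "f \<in> ?M"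
    then obtain g where g: "g \<in> G" "f = Poly_Mapping.single g 1" by auto
    then have "\<exists>h\<in>G. \<exists>d. g = h + d" by (intro bexI[of _ g] exI[of _ 0]) auto
    then show "f \<in> mono_ideal ?U" using g by (simp add: mono_ideal_def)
  qed
  then show "Idl\<^bsub>class_ring\<^esub> ?M \<subseteq> mono_ideal ?U"
    by (intro ring.genideal_minimal[OF class_ring.ring_axioms] ideal_mono_ideal up)
next
  have id: "ideal (Idl\<^bsub>class_ring\<^esub> ?M) (class_ring :: 'k poly3 ring)"
    by (rule ring.genideal_ideal[OF class_ring.ring_axioms]) auto
  have sub: "?M \<subseteq> Idl\<^bsub>class_ring\<^esub> ?M" by (rule ring.genideal_self[OF class_ring.ring_axioms]) auto
  show "mono_ideal ?U \<subseteq> Idl\<^bsub>class_ring\<^esub> ?M"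
  proof (rule mono_ideal_subset[OF id])
    fix m assume "m \<in> ?U"
    then obtain g d where "g \<in> G" "m = g + d" by auto
    then have "Poly_Mapping.single m (1::'k) = Poly_Mapping.single d 1 * Poly_Mapping.single g 1"
      by (simp add: mult_single add.commute)
    then show "Poly_Mapping.single m (1::'k) \<in> Idl\<^bsub>class_ring\<^esub> ?M"
      using sub \<open>g \<in> G\<close> id unfolding ideal_class_ring_iff by auto
  qed
qed

lemma var_power: "var i ^ n = Poly_Mapping.single (Poly_Mapping.single i n) 1"
  by (induction n) (auto simp: var_def mult_single single_add[symmetric])

lemma poly_mapping_diff:
  fixes m g :: "'x \<Rightarrow>\<^sub>0 nat"
  shows "(\<exists>d. m = g + d) \<longleftrightarrow> (\<forall>i. lookup g i \<le> lookup m i)"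
proof
  assume "\<forall>i. lookup g i \<le> lookup m i"
  then have "m = g + (m - g)" by (intro poly_mapping_eqI) (simp add: lookup_add lookup_minus)
  then show "\<exists>d. m = g + d" by blast
qed (auto simp: lookup_add)

lemma single_le_iff:
  fixes m :: "'x \<Rightarrow>\<^sub>0 nat"
  shows "(\<exists>d. m = Poly_Mapping.single i n + d) \<longleftrightarrow> n \<le> lookup m i"
  by (auto simp: poly_mapping_diff lookup_single when_def)

lemma genideal_var_powers:
  "Idl\<^bsub>class_ring\<^esub> {var i ^ a, var j} = (mono_ideal {m. a \<le> lookup m i \<or> 0 < lookup m j} :: 'k::field poly3 set)"
proof -
  have *: "{var i ^ a, var j} = (\<lambda>m. Poly_Mapping.single m (1::'k)) ` {Poly_Mapping.single i a, Poly_Mapping.single j 1}"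
    using var_power[of j 1, where ?'a = 'k] by (simp add: var_power)
  show ?thesis unfolding * genideal_monomials by (simp add: single_le_iff Suc_le_eq)
qed

lemma mono_ideal_Int: "mono_ideal U \<inter> mono_ideal V = mono_ideal (U \<inter> V)"
  by (auto simp: mono_ideal_def)

lemma max_ideal_eq: "max_ideal = (mono_ideal {m. m \<noteq> 0} :: 'k::field poly3 set)"
proof -
  have *: "{varx, vary, varz} = (\<lambda>m. Poly_Mapping.single m (1::'k)) `
      {Poly_Mapping.single 0 1, Poly_Mapping.single 1 1, Poly_Mapping.single 2 1}"
    by (simp add: var_def)
  have "m \<noteq> 0 \<longleftrightarrow> 0 < lookup m 0 \<or> 0 < lookup m 1 \<or> 0 < lookup m 2" for m :: "3 \<Rightarrow>\<^sub>0 nat"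
    unfolding poly_mapping_eq_iff fun_eq_iff three_all by simp
  then show ?thesis
    unfolding max_ideal_def * genideal_monomials by (simp add: single_le_iff Suc_le_eq)
qed

primrec nsum :: "'m::monoid_add set \<Rightarrow> nat \<Rightarrow> 'm set" where
  "nsum U 0 = UNIV"
| "nsum U (Suc n) = {u + v |u v. u \<in> nsum U n \<and> v \<in> U}"

lemma upset_sumset: "upset V \<Longrightarrow> upset {u + v |u v. u \<in> U \<and> v \<in> V}"
  unfolding upset_def by (auto simp: add.assoc) blast

lemma ideal_prod_mono_ideal:
  assumes "upset U" "upset V"
  shows "ideal_prod class_ring (mono_ideal U) (mono_ideal V)
    = (mono_ideal {u + v |u v. u \<in> U \<and> v \<in> V} :: 'k::field poly3 set)" (is "?L = mono_ideal ?W")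
proof
  have up: "upset ?W" by (rule upset_sumset[OF assms(2)])
  show "?L \<subseteq> mono_ideal ?W"
  proof
    fix f assume "f \<in> ?L"
    then show "f \<in> mono_ideal ?W"
    proof induction
      case (prod i j)
      have "keys (i * j) \<subseteq> {x + y |x y. x \<in> keys i \<and> y \<in> keys j}" by (rule keys_mult)
      also have "\<dots> \<subseteq> ?W" using prod by (auto simp: mono_ideal_def)
      finally show ?case by (simp add: mono_ideal_def)
    next
      case (sum s1 s2)
      then show ?case using ideal_mono_ideal[OF up, where ?'a = 'k] by (auto simp: ideal_class_ring_iff)
    qed
  qed
  have id: "ideal ?L class_ring"
    by (intro ring.ideal_prod_is_ideal[OF class_ring.ring_axioms] ideal_mono_ideal assms)
  show "mono_ideal ?W \<subseteq> ?L"
  proof (rule mono_ideal_subset[OF id])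
    fix m assume "m \<in> ?W"
    then obtain u v where "m = u + v" "u \<in> U" "v \<in> V" by auto
    then have "Poly_Mapping.single m (1::'k) = Poly_Mapping.single u 1 \<otimes>\<^bsub>class_ring\<^esub> Poly_Mapping.single v 1"
      by (simp add: mult_single)
    also have "\<dots> \<in> ?L"
      using \<open>u \<in> U\<close> \<open>v \<in> V\<close> by (intro ideal_prod.prod) (auto simp: mono_ideal_def)
    finally show "Poly_Mapping.single m (1::'k) \<in> ?L" .
  qed
qed

lemma upset_nsum: "upset U \<Longrightarrow> upset (nsum U n)"
  by (cases n) (auto simp: upset_sumset, simp add: upset_def)

lemma ideal_power_mono_ideal:
  assumes "upset U"
  shows "ideal_power (mono_ideal U) n = (mono_ideal (nsum U n) :: 'k::field poly3 set)"
proof (induction n)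
  case 0
  then show ?case by (simp add: ideal_power_def nat_pow_def ideals_set_def mono_ideal_def)
next
  case (Suc n)
  have "ideal_power (mono_ideal U) (Suc n)
      = ideal_prod class_ring (ideal_power (mono_ideal U) n) (mono_ideal U :: 'k poly3 set)"
    by (simp add: ideal_power_def nat_pow_def ideals_set_def)
  then show ?case using ideal_prod_mono_ideal[OF upset_nsum[OF assms] assms] Suc by simp
qed

section \<open>Localization\<close>

text \<open>
  The fractions with numerator in \<open>J\<close> and denominator outside \<open>P\<close> are the extension of \<open>J\<close> to the
  local ring; clearing the denominator in \<open>f/1 = g/s\<close> gives the elementwise description.
\<close>

lemma local_contraction_eq:
  fixes P J :: "'r::idom set"
  assumes P: "primeideal P class_ring" and J: "ideal J class_ring"
  shows "local_contraction P J = {f. \<exists>s. s \<notin> P \<and> s * f \<in> J}"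
proof -
  interpret P: primeideal P "class_ring :: 'r ring" by fact
  have one: "1 \<notin> P" using P.I_notcarr P.one_imp_carrier by auto
  have mult: "s * t \<notin> P" if "s \<notin> P" "t \<notin> P" for s t
    using P.I_prime[of s t] that by auto
  have zero: "0 \<in> P" using P.is_ideal unfolding ideal_class_ring_iff by blast
  then have nz: "s \<noteq> 0" if "s \<notin> P" for s using that by blast
  have J0: "0 \<in> J" and Jadd: "\<And>x y. x \<in> J \<Longrightarrow> y \<in> J \<Longrightarrow> x + y \<in> J"
    and Jmult: "\<And>r x. x \<in> J \<Longrightarrow> r * x \<in> J"
    using J unfolding ideal_class_ring_iff by auto
  let ?C = "{Fract a s | a s. s \<notin> P}"
  have L: "local_ring P = class_ring\<lparr>carrier := ?C\<rparr>" by (simp add: local_ring_def)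
  have "subring ?C (class_ring :: 'r fract ring)"
  proof (rule ring.subringI[OF class_ring.ring_axioms])
    show "\<one>\<^bsub>class_ring\<^esub> \<in> ?C" using one by (auto simp: One_fract_def)
    fix x y assume "x \<in> ?C" "y \<in> ?C"
    then obtain p s q t where x: "x = Fract p s" "y = Fract q t" "s \<notin> P" "t \<notin> P" by auto
    then have "x + y = Fract (p * t + q * s) (s * t)" "x * y = Fract (p * q) (s * t)"
      by (simp_all add: nz)
    then show "x \<otimes>\<^bsub>class_ring\<^esub> y \<in> ?C" "x \<oplus>\<^bsub>class_ring\<^esub> y \<in> ?C"
      using mult x by auto
  next
    fix x assume "x \<in> ?C"
    then obtain p s where "x = Fract p s" "s \<notin> P" by auto
    then have "- x = Fract (- p) s" by simp
    then show "\<ominus>\<^bsub>class_ring\<^esub> x \<in> ?C" using \<open>s \<notin> P\<close> by (auto simp: class_ring_simps)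
  qed auto
  then have ring: "ring (local_ring P)"
    unfolding L by (rule ring.subring_is_ring[OF class_ring.ring_axioms])
  let ?J = "{Fract g s | g s. g \<in> J \<and> s \<notin> P}"
  have id: "ideal ?J (local_ring P)"
  proof (rule ideal_criterion[OF ring])
    show "?J \<subseteq> carrier (local_ring P)" by (auto simp: L)
    show "\<zero>\<^bsub>local_ring P\<^esub> \<in> ?J" using one J0 by (auto simp: L Zero_fract_def)
  next
    fix x y assume "x \<in> ?J" "y \<in> ?J"
    then obtain p s q t where x: "x = Fract p s" "y = Fract q t" "s \<notin> P" "t \<notin> P" "p \<in> J" "q \<in> J" by auto
    then have "x + y = Fract (t * p + s * q) (s * t)" by (simp add: nz mult.commute)
    moreover have "t * p + s * q \<in> J" using x by (intro Jadd Jmult)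
    ultimately show "x \<oplus>\<^bsub>local_ring P\<^esub> y \<in> ?J" using mult x by (auto simp: L)
  next
    fix r x assume "r \<in> carrier (local_ring P)" "x \<in> ?J"
    then obtain p s q t where x: "r = Fract p s" "x = Fract q t" "s \<notin> P" "t \<notin> P" "q \<in> J" by (auto simp: L)
    then have "r * x = Fract (p * q) (s * t)" by simp
    then show "r \<otimes>\<^bsub>local_ring P\<^esub> x \<in> ?J" "x \<otimes>\<^bsub>local_ring P\<^esub> r \<in> ?J"
      using mult[of s t] x Jmult[of q p] by (auto simp: L mult.commute)
  qed
  show ?thesis
  proof (intro equalityI subsetI)
    fix f assume "f \<in> local_contraction P J"
    then have "Fract f 1 \<in> Idl\<^bsub>local_ring P\<^esub> ((\<lambda>f. Fract f 1) ` J)" by (simp add: local_contraction_def)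
    also have "\<dots> \<subseteq> ?J"
      by (rule ring.genideal_minimal[OF ring id]) (use one in auto)
    finally obtain g s where "Fract f 1 = Fract g s" "g \<in> J" "s \<notin> P" by auto
    then have "s * f = g" using nz by (simp add: eq_fract mult.commute)
    then show "f \<in> {f. \<exists>s. s \<notin> P \<and> s * f \<in> J}" using \<open>g \<in> J\<close> \<open>s \<notin> P\<close> by auto
  next
    fix f assume "f \<in> {f. \<exists>s. s \<notin> P \<and> s * f \<in> J}"
    then obtain s where s: "s \<notin> P" "s * f \<in> J" by auto
    show "f \<in> local_contraction P J"
      unfolding local_contraction_def genideal_def
    proof (clarsimp)
      fix K assume K: "ideal K (local_ring P)" "(\<lambda>f. Fract f 1) ` J \<subseteq> K"
      have "Fract 1 s \<in> carrier (local_ring P)" using s by (auto simp: L)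
      moreover have "Fract (s * f) 1 \<in> K" using K(2) s by auto
      ultimately have "Fract 1 s \<otimes>\<^bsub>local_ring P\<^esub> Fract (s * f) 1 \<in> K"
        using ideal.I_l_closed[OF K(1)] by blast
      moreover have "Fract 1 s * Fract (s * f) 1 = Fract f 1" using nz[OF s(1)] by (simp add: eq_fract)
      ultimately show "Fract f 1 \<in> K" by (simp add: L)
    qed
  qed
qed

section \<open>Monomial ideals primary to a coordinate axis\<close>

text \<open>
  Relabels the variables cyclically so that \<open>e\<close> comes last. The lexicographic order on the relabelled
  exponents then compares the other two variables first.
\<close>

definition rotated :: "3 \<Rightarrow> (3 \<Rightarrow>\<^sub>0 nat) \<Rightarrow> (3 \<Rightarrow>\<^sub>0 nat)"
  where "rotated e m = Poly_Mapping.map_key (\<lambda>i. i + (e + 1)) m"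

lemma lookup_rotated: "lookup (rotated e m) i = lookup m (i + (e + 1))"
  unfolding rotated_def by (subst map_key.rep_eq) (auto simp: inj_def)

lemma rotated_add: "rotated e (m + m') = rotated e m + rotated e m'"
  by (rule poly_mapping_eqI) (simp add: lookup_rotated lookup_add)

lemma rotated_inject: "rotated e m = rotated e m' \<longleftrightarrow> m = m'"
  unfolding poly_mapping_eq_iff fun_eq_iff lookup_rotated
  by (metis diff_add_cancel)

lemma least_key:
  assumes "f \<noteq> 0"
  obtains m where "m \<in> keys f" "\<And>m'. m' \<in> keys f \<Longrightarrow> rotated e m \<le> rotated e m'"
proof -
  have "finite (rotated e ` keys f)" "rotated e ` keys f \<noteq> {}" using assms by auto
  from Min_in[OF this] obtain m where "m \<in> keys f" "rotated e m = Min (rotated e ` keys f)" by auto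
  then show thesis using that by simp
qed

text \<open>
  The product of the two lowest terms cannot cancel.
\<close>

lemma add_least_keys_in_keys_mult:
  fixes f g :: "'k::field poly3"
  assumes m: "m \<in> keys f" "\<And>m'. m' \<in> keys f \<Longrightarrow> rotated e m \<le> rotated e m'"
    and n: "n \<in> keys g" "\<And>n'. n' \<in> keys g \<Longrightarrow> rotated e n \<le> rotated e n'"
  shows "m + n \<in> keys (f * g)"
proof -
  define f' where "f' = f - Poly_Mapping.single m (lookup f m)"
  define g' where "g' = g - Poly_Mapping.single n (lookup g n)"
  have f: "f = Poly_Mapping.single m (lookup f m) + f'" by (simp add: f'_def)
  have g: "g = Poly_Mapping.single n (lookup g n) + g'" by (simp add: g'_def)
  have kf: "keys f' \<subseteq> keys f - {m}" and kg: "keys g' \<subseteq> keys g - {n}"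
    by (auto simp: f'_def g'_def in_keys_iff lookup_minus lookup_single when_def split: if_splits)
  have 1: "lookup (Poly_Mapping.single m (lookup f m) * g') (m + n) = 0"
  proof -
    have "m + n \<notin> {x + y |x y. x \<in> keys (Poly_Mapping.single m (lookup f m)) \<and> y \<in> keys g'}"
      using kg by (auto split: if_splits)
    then show ?thesis using keys_mult unfolding in_keys_iff[symmetric] not_in_keys_iff_lookup_eq_zero[symmetric] by blast
  qed
  have 2: "lookup (f' * g) (m + n) = 0"
  proof -
    have "rotated e m + rotated e n < rotated e x + rotated e y" if "x \<in> keys f'" "y \<in> keys g" for x y
    proof -
      have "rotated e m \<le> rotated e x" "m \<noteq> x" using m that kf by auto
      then have "rotated e m < rotated e x" using rotated_inject by (metis order_le_less)
      then show ?thesis using n(2)[OF that(2)] by (rule add_less_le_mono)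
    qed
    then have "m + n \<notin> {x + y |x y. x \<in> keys f' \<and> y \<in> keys g}"
      by (auto simp flip: rotated_add) (metis less_irrefl)
    then show ?thesis using keys_mult unfolding in_keys_iff[symmetric] not_in_keys_iff_lookup_eq_zero[symmetric] by blast
  qed
  have "f * g = Poly_Mapping.single m (lookup f m) * (Poly_Mapping.single n (lookup g n) + g') + f' * g"
    by (metis f g distrib_right)
  then have "lookup (f * g) (m + n) = lookup f m * lookup g n"
    using 1 2 by (simp add: lookup_add distrib_left mult_single)
  then show ?thesis using m n by (simp add: in_keys_iff)
qed

lemma split_keys:
  fixes f :: "'x \<Rightarrow>\<^sub>0 'y::ab_group_add"
  obtains g h where "f = g + h" "keys g = keys f - U" "keys h = keys f \<inter> U"
proof
  let ?r = "\<lambda>A. \<Sum>m\<in>keys f \<inter> A. Poly_Mapping.single m (lookup f m)"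
  have l: "lookup (?r A) m = (if m \<in> A then lookup f m else 0)" for A m
    by (auto simp: lookup_sum lookup_single when_def in_keys_iff sum.delta)
  show "f = ?r (- U) + ?r U" by (rule poly_mapping_eqI) (auto simp: lookup_add l)
  show "keys (?r (- U)) = keys f - U" "keys (?r U) = keys f \<inter> U"
    by (auto simp: in_keys_iff l split: if_splits)
qed

text \<open>
  The exponents of the monomials in the prime ideal of the axis of variable \<open>e\<close>, which is generated by
  the other two variables. Indices are added in \<open>\<int>/3\<close>.
\<close>

definition off_axis :: "3 \<Rightarrow> (3 \<Rightarrow>\<^sub>0 nat) set"
  where "off_axis e = {m. 0 < lookup m (e + 1) \<or> 0 < lookup m (e + 2)}"

text \<open>
  Modulo \<open>U\<close> one may drop the terms of \<open>f\<close> in \<open>U\<close>. The lowest term of \<open>s\<close> is a power of variable \<open>e\<close>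
  alone, so multiplying the lowest remaining term of \<open>f\<close> by it does not lead into \<open>U\<close>, and this
  product does not cancel.
\<close>

lemma primary_mono_ideal:
  fixes s f :: "'k::field poly3"
  assumes up: "upset U"
    and inv: "\<And>m m'. m \<in> U \<Longrightarrow> lookup m (e + 1) = lookup m' (e + 1)
                \<Longrightarrow> lookup m (e + 2) = lookup m' (e + 2) \<Longrightarrow> m' \<in> U"
    and s: "s \<notin> mono_ideal (off_axis e)" and sf: "s * f \<in> mono_ideal U"
  shows "f \<in> mono_ideal U"
proof (rule ccontr)
  assume f: "f \<notin> mono_ideal U"
  obtain g h where gh: "f = g + h" "keys g = keys f - U" "keys h = keys f \<inter> U"
    by (rule split_keys)
  have "keys g \<noteq> {}" using f unfolding gh(2) mono_ideal_def by blast
  then have "g \<noteq> 0" by auto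
  then obtain n where n: "n \<in> keys g" "\<And>n'. n' \<in> keys g \<Longrightarrow> rotated e n \<le> rotated e n'"
    using least_key by metis
  obtain t where t: "t \<in> keys s" "t \<notin> off_axis e" using s by (auto simp: mono_ideal_def)
  then have "s \<noteq> 0" by auto
  then obtain m where m: "m \<in> keys s" "\<And>m'. m' \<in> keys s \<Longrightarrow> rotated e m \<le> rotated e m'"
    using least_key by metis
  have m0: "lookup m (e + 1) = 0 \<and> lookup m (e + 2) = 0"
  proof (rule ccontr)
    assume *: "\<not> ?thesis"
    have "rotated e t < rotated e m"
    proof (cases "lookup m (e + 1) = 0")
      case True
      then have "lookup (rotated e t) 1 < lookup (rotated e m) 1 \<and>
          (\<forall>i<1. lookup (rotated e t) i = lookup (rotated e m) i)"
        using * t(2) by (simp add: lookup_rotated three_less off_axis_def add_ac)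
      then show ?thesis unfolding less_poly_mapping.rep_eq less_fun_def by blast
    next
      case False
      then have "lookup (rotated e t) 0 < lookup (rotated e m) 0 \<and>
          (\<forall>i<0. lookup (rotated e t) i = lookup (rotated e m) i)"
        using t(2) by (simp add: lookup_rotated three_less off_axis_def)
      then show ?thesis unfolding less_poly_mapping.rep_eq less_fun_def by blast
    qed
    then show False using m(2)[OF t(1)] by simp
  qed
  have "keys (s * h) \<subseteq> U" by (intro keys_mult_upset up) (simp add: gh(3))
  moreover have "m + n \<notin> U"
  proof
    assume "m + n \<in> U"
    then have "n \<in> U" by (rule inv) (use m0 in \<open>auto simp: lookup_add\<close>)
    then show False using n(1) unfolding gh(2) by blast
  qed
  ultimately have "lookup (s * h) (m + n) = 0"
    unfolding not_in_keys_iff_lookup_eq_zero[symmetric] by blast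
  moreover have "lookup (s * g) (m + n) \<noteq> 0"
    using add_least_keys_in_keys_mult[OF m n] by (simp add: in_keys_iff)
  ultimately have "m + n \<in> keys (s * f)" using gh(1) by (simp add: in_keys_iff distrib_left lookup_add)
  then show False using sf \<open>m + n \<notin> U\<close> unfolding mono_ideal_def by blast
qed

lemma upset_off_axis: "upset (off_axis e)"
  by (auto simp: upset_def off_axis_def lookup_add)

lemma off_axis_cong:
  assumes "m \<in> off_axis e" "lookup m (e + 1) = lookup m' (e + 1)" "lookup m (e + 2) = lookup m' (e + 2)"
  shows "m' \<in> off_axis e"
  using assms by (simp add: off_axis_def)

lemma primeideal_axis: "primeideal (mono_ideal (off_axis e) :: 'k::field poly3 set) class_ring"
proof (rule primeidealI[OF ideal_mono_ideal[OF upset_off_axis] class_cring.cring_axioms])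
  have "(1 :: 'k poly3) \<notin> mono_ideal (off_axis e)" by (simp add: mono_ideal_def off_axis_def)
  then show "carrier class_ring \<noteq> (mono_ideal (off_axis e) :: 'k poly3 set)" by auto
next
  fix s f :: "'k poly3"
  assume "s \<otimes>\<^bsub>class_ring\<^esub> f \<in> mono_ideal (off_axis e)"
  then have sf: "s * f \<in> mono_ideal (off_axis e)" by simp
  show "s \<in> mono_ideal (off_axis e) \<or> f \<in> mono_ideal (off_axis e)"
  proof (cases "s \<in> mono_ideal (off_axis e)")
    case False
    have "f \<in> mono_ideal (off_axis e)"
      by (rule primary_mono_ideal[OF upset_off_axis _ False sf]) (rule off_axis_cong)
    then show ?thesis ..
  qed simp
qed

section \<open>Symbolic powers\<close>

text \<open>
  The exponents of the \<open>n\<close>-th power of \<open>(x\<^sup>w, y)\<close>, where \<open>x\<close>, \<open>y\<close>, \<open>z\<close> are the variables \<open>e + 1\<close>, \<open>e + 2\<close>,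
  \<open>e\<close> and \<open>w\<close> stands for \<open>w e\<close>. The theorem uses \<open>w 2 = a\<close>, \<open>w 0 = b\<close>, \<open>w 1 = c\<close>; indexing by \<open>\<int>/3\<close>
  makes the three components interchangeable.
\<close>

definition facet :: "(3 \<Rightarrow> nat) \<Rightarrow> 3 \<Rightarrow> nat \<Rightarrow> (3 \<Rightarrow>\<^sub>0 nat) set"
  where "facet w e n = {m. n \<le> lookup m (e + 1) div w e + lookup m (e + 2)}"

definition symb :: "(3 \<Rightarrow> nat) \<Rightarrow> nat \<Rightarrow> (3 \<Rightarrow>\<^sub>0 nat) set"
  where "symb w n = (\<Inter>e. facet w e n)"

lemma upset_facet: "upset (facet w e n)"
proof -
  have "n \<le> (p + p') div k + (q + q')" if "n \<le> p div k + q" for p q p' q' k :: nat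
    by (rule order_trans[OF that add_mono[OF div_le_mono]]) simp_all
  then show ?thesis by (simp add: upset_def facet_def lookup_add)
qed

lemma upset_symb: "upset (symb w n)"
  using upset_facet[of w _ n] unfolding symb_def upset_def by blast

lemma facet_primary:
  assumes "s \<notin> mono_ideal (off_axis e)" "s * f \<in> mono_ideal (facet w e n)"
  shows "f \<in> mono_ideal (facet w e n)"
  by (rule primary_mono_ideal[OF upset_facet _ assms]) (auto simp: facet_def)

abbreviation coords :: "3 \<Rightarrow> (3 \<Rightarrow>\<^sub>0 nat) \<Rightarrow> nat \<times> nat \<times> nat"
  where "coords e m \<equiv> (lookup m (e + 1), lookup m (e + 2), lookup m e)"

definition pow_exps :: "(3 \<Rightarrow> nat) \<Rightarrow> nat \<Rightarrow> (3 \<Rightarrow>\<^sub>0 nat) set"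
  where "pow_exps w n = {m. coords 2 m \<in> power_exps (w 2) (w 0) (w 1) n}"

lemma symb_coords: "m \<in> symb w n \<longleftrightarrow> coords e m \<in> symb_exps (w e) (w (e + 1)) (w (e + 2)) n"
  unfolding symb_def facet_def INT_iff three_all_rotate[where e = e] mem_Collect_eq symb_exps_def
  by (auto simp: three_arith three_all_rotate[where e = e])

lemma pow_exps_coords: "m \<in> pow_exps w n \<longleftrightarrow> coords e m \<in> power_exps (w e) (w (e + 1)) (w (e + 2)) n"
proof -
  have *: "coords e m \<in> power_exps (w e) (w (e + 1)) (w (e + 2)) n
     \<longleftrightarrow> coords (e + 1) m \<in> power_exps (w (e + 1)) (w (e + 2)) (w e) n" for e
    by (simp add: three_arith power_exps_rotate[of "lookup m (e + 1)" "lookup m (e + 2)"])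
  show ?thesis
    using *[of 0] *[of 1] *[of 2] by (cases e rule: three_cases) (simp_all add: pow_exps_def three_wrap)
qed

lemma symb_subset_facet: "symb w n \<subseteq> facet w e n"
  by (auto simp: symb_def)

definition triple :: "3 \<Rightarrow> nat \<Rightarrow> nat \<Rightarrow> nat \<Rightarrow> (3 \<Rightarrow>\<^sub>0 nat)"
  where "triple e i j k = Poly_Mapping.single (e + 1) i + Poly_Mapping.single (e + 2) j + Poly_Mapping.single e k"

lemma lookup_triple [simp]:
  "lookup (triple e i j k) (e + 1) = i" "lookup (triple e i j k) (e + 2) = j" "lookup (triple e i j k) e = k"
  using three_neq[of e] by (auto simp: triple_def lookup_add lookup_single when_def)

lemma nsum_symb: 
  assumes w: "\<And>e. w e > 0"
  shows "nsum (symb w 1) n = pow_exps w n"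
proof (induction n)
  case 0
  then show ?case by (simp add: pow_exps_def power_exps_def)
next
  case (Suc n)
  show ?case
  proof (intro equalityI subsetI)
    fix m assume "m \<in> nsum (symb w 1) (Suc n)"
    then obtain u v where uv: "m = u + v" "u \<in> pow_exps w n" "v \<in> symb w 1"
      unfolding nsum.simps Suc by blast
    then have "coords 2 v \<in> power_exps (w 2) (w (2 + 1)) (w (2 + 2)) 1"
      using symb_exps_1_imp[OF w w w] uv(3) unfolding symb_coords[of v w 1 2] by blast
    moreover have "coords 2 u \<in> power_exps (w 2) (w (2 + 1)) (w (2 + 2)) n"
      using uv(2) unfolding pow_exps_coords[of _ _ _ 2] .
    ultimately have "coords 2 (u + v) \<in> power_exps (w 2) (w (2 + 1)) (w (2 + 2)) (n + 1)"
      unfolding lookup_add by (intro power_exps_add)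
    then show "m \<in> pow_exps w (Suc n)"
      unfolding pow_exps_coords[of _ _ _ 2] uv(1) Suc_eq_plus1 .
  next
    fix m assume "m \<in> pow_exps w (Suc n)"
    then have "coords 2 m \<in> power_exps (w 2) (w (2 + 1)) (w (2 + 2)) (Suc n)"
      unfolding pow_exps_coords[of _ _ _ 2] .
    then obtain i j k x y z where *: "(x, y, z) \<in> symb_exps (w 2) (w (2 + 1)) (w (2 + 2)) 1"
        "(i, j, k) \<in> power_exps (w 2) (w (2 + 1)) (w (2 + 2)) n"
        "lookup m (2 + 1) = i + x" "lookup m (2 + 2) = j + y" "lookup m 2 = k + z"
      by (rule power_exps_SucE[OF w w w])
    have "m = triple 2 i j k + triple 2 x y z"
      unfolding poly_mapping_eq_iff fun_eq_iff three_all_rotate[where e = 2] lookup_add lookup_triple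
      by (intro conjI *)
    moreover have "triple 2 i j k \<in> pow_exps w n" "triple 2 x y z \<in> symb w 1"
      unfolding pow_exps_coords[of _ _ _ 2] symb_coords[of _ _ _ 2] lookup_triple by (rule *)+
    ultimately show "m \<in> nsum (symb w 1) (Suc n)" unfolding nsum.simps Suc by blast
  qed
qed

lemma upset_pow_exps:
  assumes w: "\<And>e. w e > 0"
  shows "upset (pow_exps w n)"
  unfolding nsum_symb[OF w, symmetric] by (intro upset_nsum upset_symb)

lemma pow_exps_subset_facet:
  assumes w: "\<And>e. w e > 0"
  shows "pow_exps w n \<subseteq> facet w e n"
proof
  fix m assume "m \<in> pow_exps w n"
  then obtain p q r s where pqrs: "p + q + r + s = n" "p + w e * q + r \<le> lookup m (e + 1)"
      "p + w (e + 1) * r + s \<le> lookup m (e + 2)"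
    by (auto simp: pow_exps_coords[of _ _ _ e] power_exps_def)
  have "(w e * q) div w e \<le> lookup m (e + 1) div w e" by (rule div_le_mono) (use pqrs in linarith)
  then have "q \<le> lookup m (e + 1) div w e" using w[of e] by simp
  moreover have "r \<le> w (e + 1) * r" using w[of "e + 1"] by simp
  ultimately show "m \<in> facet w e n" unfolding facet_def mem_Collect_eq using pqrs by linarith
qed

lemma pow_exps_subset_symb: "(\<And>e. w e > 0) \<Longrightarrow> pow_exps w n \<subseteq> symb w n"
  using pow_exps_subset_facet unfolding symb_def by blast

text \<open>
  A high power of the variable \<open>e\<close>, which lies outside the prime, moves every exponent of the facet
  into those of the ordinary power: take as many generators \<open>x\<^sup>wz\<close> as the first coordinate admits,
  and \<open>yz\<^sup>w\<close> for the rest.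
\<close>

lemma local_contraction_axis:
  assumes w: "\<And>e. w e > 0"
  shows "local_contraction (mono_ideal (off_axis e)) (mono_ideal (pow_exps w n))
    = (mono_ideal (facet w e n) :: 'k::field poly3 set)"
proof -
  note up = upset_pow_exps[OF w, where n = n]
  have sub: "pow_exps w n \<subseteq> facet w e n" by (rule pow_exps_subset_facet[OF w])
  show ?thesis
    unfolding local_contraction_eq[OF primeideal_axis ideal_mono_ideal[OF up]]
  proof (intro equalityI subsetI; clarify)
    fix f s :: "'k poly3"
    assume "s \<notin> mono_ideal (off_axis e)" "s * f \<in> mono_ideal (pow_exps w n)"
    moreover from this have "s * f \<in> mono_ideal (facet w e n)" using sub by (auto simp: mono_ideal_def)
    ultimately show "f \<in> mono_ideal (facet w e n)" using facet_primary by blast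
  next
    fix f :: "'k poly3" assume f: "f \<in> mono_ideal (facet w e n)"
    let ?d = "Poly_Mapping.single e (n + w (e + 2) * n)"
    let ?s = "Poly_Mapping.single ?d (1::'k)"
    have "?d + m \<in> pow_exps w n" if "m \<in> facet w e n" for m
    proof -
      let ?q = "min (lookup m (e + 1) div w e) n"
      have "w e * ?q \<le> w e * (lookup m (e + 1) div w e)" by (intro mult_left_mono) auto
      also have "\<dots> \<le> lookup m (e + 1)" by simp
      finally have 1: "0 + w e * ?q + 0 \<le> lookup m (e + 1)" by simp
      have 2: "0 + w (e + 1) * 0 + (n - ?q) \<le> lookup m (e + 2)" using that by (auto simp: facet_def)
      have 3: "0 + ?q + w (e + 2) * (n - ?q) \<le> lookup m e + (n + w (e + 2) * n)"
        by (intro add_mono order_trans[OF _ le_add2]) auto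
      have 4: "0 + ?q + 0 + (n - ?q) = n" by simp
      have "lookup (?d + m) (e + 1) = lookup m (e + 1)" "lookup (?d + m) (e + 2) = lookup m (e + 2)"
        "lookup (?d + m) e = lookup m e + (n + w (e + 2) * n)"
        using three_neq[of e] by (auto simp: lookup_add lookup_single when_def)
      then show ?thesis
        unfolding pow_exps_coords[of _ _ _ e] power_exps_def mem_Collect_eq prod.case
        by (simp only:)
           (rule exI[of _ 0], rule exI[of _ ?q], rule exI[of _ 0], rule exI[of _ "n - ?q"],
            intro conjI, rule 4, rule 1, rule 2, rule 3)
    qed
    then have "keys (?s * f) \<subseteq> pow_exps w n"
      using keys_mult[of ?s f] f by (auto simp: mono_ideal_def dest!: subsetD)
    moreover have "?d \<notin> off_axis e" using three_neq[of e] by (auto simp: off_axis_def lookup_single)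
    ultimately show "\<exists>s. s \<notin> mono_ideal (off_axis e) \<and> s * f \<in> mono_ideal (pow_exps w n)"
      by (intro exI[of _ ?s]) (auto simp: mono_ideal_def)
  qed
qed

lemma assoc_primes_quot:
  fixes J :: "'r::comm_ring_1 set"
  assumes "ideal J class_ring"
  shows "P \<in> assoc_primes class_ring (quot_module (ideal_module class_ring UNIV) J)
    \<longleftrightarrow> primeideal P class_ring \<and> (\<exists>f. P = {r. r * f \<in> J})"
proof -
  let ?M = "ideal_module class_ring (UNIV :: 'r set)"
  let ?Q = "quot_module ?M J"
  have J: "0 \<in> J" "\<And>x y. x \<in> J \<Longrightarrow> y \<in> J \<Longrightarrow> x + y \<in> J" "\<And>r x. x \<in> J \<Longrightarrow> r * x \<in> J"
    using assms unfolding ideal_class_ring_iff by auto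
  have minus: "x - y \<in> J" if "x \<in> J" "y \<in> J" for x y
    using J(2)[OF that(1) J(3)[OF that(2), of "- 1"]] by simp
  have coset: "J +>\<^bsub>?M\<^esub> f = {x. x - f \<in> J}" for f
    by (force simp: a_r_coset_def' ideal_module_def)
  have carrier: "carrier ?Q = range (\<lambda>f. J +>\<^bsub>?M\<^esub> f)"
    by (auto simp: quot_module_def A_RCOSETS_def' ideal_module_def)
  have smult: "r \<odot>\<^bsub>?Q\<^esub> (J +>\<^bsub>?M\<^esub> f) = \<zero>\<^bsub>?Q\<^esub> \<longleftrightarrow> r * f \<in> J" for r f
  proof -
    have "r \<odot>\<^bsub>?Q\<^esub> (J +>\<^bsub>?M\<^esub> f) = {j + r * x |j x. j \<in> J \<and> x - f \<in> J}"
      unfolding coset by (auto simp: quot_module_def set_add_def' ideal_module_def)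
    also have "\<dots> = {x. x - r * f \<in> J}"
    proof (intro equalityI subsetI; clarify)
      fix j x assume "j \<in> J" "x - f \<in> J"
      then have "j + r * (x - f) \<in> J" using J by blast
      then show "j + r * x - r * f \<in> J" by (simp add: algebra_simps)
    next
      fix x assume "x - r * f \<in> J"
      then show "\<exists>j y. x = j + r * y \<and> j \<in> J \<and> y - f \<in> J"
        by (intro exI[of _ "x - r * f"] exI[of _ f]) (simp add: J)
    qed
    finally have 1: "r \<odot>\<^bsub>?Q\<^esub> (J +>\<^bsub>?M\<^esub> f) = {x. x - r * f \<in> J}" .
    have "{x. x - r * f \<in> J} = J \<longleftrightarrow> r * f \<in> J"
    proof
      assume "r * f \<in> J"
      then show "{x. x - r * f \<in> J} = J" using minus J(2) by (metis (no_types, lifting) Collect_mem_eq Collect_cong diff_add_cancel)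
    qed (use J in auto)
    with 1 show ?thesis by (simp add: quot_module_def)
  qed
  show ?thesis
    unfolding assoc_primes_def carrier by (simp add: smult)
qed

text \<open>
  The three axis primes are associated, with explicit annihilated monomials, so they bound the symbolic
  power from above. Conversely any associated prime is a colon ideal \<open>(I : f)\<close> with \<open>f\<close> outside one of
  the primary components, hence is contained in the axis prime of that component; its contraction is
  then only larger, and the intersection does not shrink.
\<close>

lemma symbolic_power_symb:
  assumes w: "\<And>e. w e > 0"
  shows "symbolic_power (mono_ideal (symb w 1)) n = (mono_ideal (symb w n) :: 'k::field poly3 set)"
proof -
  let ?I = "mono_ideal (symb w 1) :: 'k poly3 set"
  let ?P = "\<lambda>e. mono_ideal (off_axis e) :: 'k poly3 set"
  let ?Ass = "assoc_primes class_ring (quot_module (ideal_module class_ring UNIV) ?I)"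
  have id: "ideal ?I class_ring" by (rule ideal_mono_ideal[OF upset_symb])
  have pow: "ideal_power ?I n = mono_ideal (pow_exps w n)"
    by (simp only: ideal_power_mono_ideal[OF upset_symb] nsum_symb[OF w])
  have sub: "mono_ideal (symb w n) \<subseteq> (mono_ideal (facet w e n) :: 'k poly3 set)" for e n
    using symb_subset_facet[of w n e] by (auto simp: mono_ideal_def)
  have "?P e \<in> ?Ass" for e
  proof -
    \<comment> \<open>For \<open>e = 2\<close> this is \<open>x\<^bsup>a-1\<^esup>z\<^sup>c\<close>, which lies outside \<open>(x\<^sup>a, y)\<close> and is moved into \<open>I\<close> by \<open>x\<close> and by \<open>y\<close>.\<close>
    let ?m = "triple e (w e - 1) 0 (w (e + 2))"
    let ?f = "Poly_Mapping.single ?m (1::'k)"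
    have "?m \<notin> facet w e 1" using w[of e] by (simp add: facet_def)
    then have nf: "?f \<notin> mono_ideal (facet w e 1)" by (simp add: mono_ideal_def)
    have "r * ?f \<in> ?I \<longleftrightarrow> r \<in> ?P e" for r
    proof
      assume "r * ?f \<in> ?I"
      then show "r \<in> ?P e" using sub nf facet_primary by blast
    next
      assume r: "r \<in> ?P e"
      have "x + ?m \<in> symb w 1" if "x \<in> off_axis e" for x
      proof -
        have "w e \<le> lookup x (e + 1) + (w e - 1)" if "lookup x (e + 1) > 0" using w[of e] that by linarith
        moreover have "w (e + 2) div w (e + 2) \<le> (lookup x e + w (e + 2)) div w (e + 2)"
          by (rule div_le_mono) simp
        moreover have "w (e + 2) div w (e + 2) = 1" using w[of "e + 2"] by simp
        ultimately show ?thesis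
          using that w[of "e + 2"] w[of e]
          by (auto simp: symb_coords[of _ _ _ e] symb_exps_def off_axis_def lookup_add div_greater_zero_iff Suc_le_eq)
      qed
      then have "keys (r * ?f) \<subseteq> symb w 1"
        using keys_mult[of r ?f] r by (auto simp: mono_ideal_def dest!: subsetD)
      then show "r * ?f \<in> ?I" by (simp add: mono_ideal_def)
    qed
    then show ?thesis unfolding assoc_primes_quot[OF id] using primeideal_axis by blast
  qed
  then have "symbolic_power ?I n \<subseteq> (\<Inter>e. mono_ideal (facet w e n))"
    unfolding symbolic_power_def pow using local_contraction_axis[OF w] by fastforce
  also have "\<dots> = mono_ideal (symb w n)" by (auto simp: mono_ideal_def symb_def)
  finally have 1: "symbolic_power ?I n \<subseteq> mono_ideal (symb w n)" .
  have "mono_ideal (symb w n) \<subseteq> local_contraction P (mono_ideal (pow_exps w n))" if "P \<in> ?Ass" for P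
  proof -
    obtain f where P: "primeideal P class_ring" "P = {r. r * f \<in> ?I}"
      using \<open>P \<in> ?Ass\<close> unfolding assoc_primes_quot[OF id] by blast
    have "1 \<notin> P"
      using primeideal.I_notcarr[OF P(1)] ideal.one_imp_carrier[OF primeideal.axioms(1)[OF P(1)]] by auto
    then have "f \<notin> ?I" using P(2) by simp
    then obtain e where e: "f \<notin> mono_ideal (facet w e 1)" by (auto simp: mono_ideal_def symb_def)
    have "P \<subseteq> ?P e"
    proof
      fix r assume "r \<in> P"
      then have "r * f \<in> mono_ideal (facet w e 1)" using P(2) sub by blast
      then show "r \<in> ?P e" using e facet_primary by blast
    qed
    note J = ideal_mono_ideal[OF upset_pow_exps[OF w], where ?'a = 'k]
    have "mono_ideal (facet w e n) = local_contraction (?P e) (mono_ideal (pow_exps w n))"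
      by (rule local_contraction_axis[OF w, symmetric])
    also have "\<dots> \<subseteq> local_contraction P (mono_ideal (pow_exps w n))"
      unfolding local_contraction_eq[OF P(1) J] local_contraction_eq[OF primeideal_axis J]
      using \<open>P \<subseteq> ?P e\<close> by blast
    finally show ?thesis using sub by blast
  qed
  then have "mono_ideal (symb w n) \<subseteq> symbolic_power ?I n"
    unfolding symbolic_power_def pow by blast
  with 1 show ?thesis by (rule antisym)
qed

section \<open>Quotient modules\<close>

text \<open>
  The quotient records inherit the module axioms from \<open>M\<close> through the coset map.
\<close>

lemma module_surjective_image:
  assumes M: "Module.module R M"
    and car: "carrier Q = f ` carrier M"
    and add: "\<And>x y. x \<in> carrier M \<Longrightarrow> y \<in> carrier M \<Longrightarrow> f x \<oplus>\<^bsub>Q\<^esub> f y = f (x \<oplus>\<^bsub>M\<^esub> y)"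
    and smult: "\<And>r x. r \<in> carrier R \<Longrightarrow> x \<in> carrier M \<Longrightarrow> r \<odot>\<^bsub>Q\<^esub> f x = f (r \<odot>\<^bsub>M\<^esub> x)"
    and zero: "\<zero>\<^bsub>Q\<^esub> = f \<zero>\<^bsub>M\<^esub>"
  shows "Module.module R Q"
proof -
  interpret M: Module.module R M by fact
  show ?thesis
  proof (rule module_criteria)
    show "cring R" ..
    show "\<zero>\<^bsub>Q\<^esub> \<in> carrier Q" by (simp add: car zero)
    show "\<forall>v w. v \<in> carrier Q \<and> w \<in> carrier Q \<longrightarrow> v \<oplus>\<^bsub>Q\<^esub> w \<in> carrier Q"
      by (auto simp: car add)
    show "\<forall>v\<in>carrier Q. \<exists>neg_v\<in>carrier Q. v \<oplus>\<^bsub>Q\<^esub> neg_v = \<zero>\<^bsub>Q\<^esub>"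
      unfolding car zero
    proof (intro ballI, elim imageE, hypsubst)
      fix x assume "x \<in> carrier M"
      then show "\<exists>v\<in>f ` carrier M. f x \<oplus>\<^bsub>Q\<^esub> v = f \<zero>\<^bsub>M\<^esub>"
        by (intro bexI[of _ "f (\<ominus>\<^bsub>M\<^esub> x)"]) (simp_all add: add M.r_neg)
    qed
    show "\<forall>c v. c \<in> carrier R \<and> v \<in> carrier Q \<longrightarrow> c \<odot>\<^bsub>Q\<^esub> v \<in> carrier Q"
      by (auto simp: car smult)
    show "\<forall>v w. v \<in> carrier Q \<and> w \<in> carrier Q \<longrightarrow> v \<oplus>\<^bsub>Q\<^esub> w = w \<oplus>\<^bsub>Q\<^esub> v"
      by (auto simp: car add M.a_comm)
    show "\<forall>v w x. v \<in> carrier Q \<and> w \<in> carrier Q \<and> x \<in> carrier Q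
        \<longrightarrow> v \<oplus>\<^bsub>Q\<^esub> w \<oplus>\<^bsub>Q\<^esub> x = v \<oplus>\<^bsub>Q\<^esub> (w \<oplus>\<^bsub>Q\<^esub> x)"
      by (auto simp: car add M.a_assoc)
    show "\<forall>v\<in>carrier Q. v \<oplus>\<^bsub>Q\<^esub> \<zero>\<^bsub>Q\<^esub> = v" by (auto simp: car add zero)
    show "\<forall>a b v. a \<in> carrier R \<and> b \<in> carrier R \<and> v \<in> carrier Q
        \<longrightarrow> a \<otimes>\<^bsub>R\<^esub> b \<odot>\<^bsub>Q\<^esub> v = a \<odot>\<^bsub>Q\<^esub> (b \<odot>\<^bsub>Q\<^esub> v)"
      by (auto simp: car smult M.smult_assoc1)
    show "\<forall>v\<in>carrier Q. \<one>\<^bsub>R\<^esub> \<odot>\<^bsub>Q\<^esub> v = v" by (auto simp: car smult)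
    show "\<forall>a b v. a \<in> carrier R \<and> b \<in> carrier R \<and> v \<in> carrier Q
        \<longrightarrow> (a \<oplus>\<^bsub>R\<^esub> b) \<odot>\<^bsub>Q\<^esub> v = a \<odot>\<^bsub>Q\<^esub> v \<oplus>\<^bsub>Q\<^esub> b \<odot>\<^bsub>Q\<^esub> v"
      by (auto simp: car smult add M.smult_l_distr)
    show "\<forall>a v w. a \<in> carrier R \<and> v \<in> carrier Q \<and> w \<in> carrier Q
        \<longrightarrow> a \<odot>\<^bsub>Q\<^esub> (v \<oplus>\<^bsub>Q\<^esub> w) = a \<odot>\<^bsub>Q\<^esub> v \<oplus>\<^bsub>Q\<^esub> a \<odot>\<^bsub>Q\<^esub> w"
      by (auto simp: car smult add M.smult_r_distr)
  qed
qed

lemma submodule_abelian_subgroup: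
  assumes "submodule R N M"
  shows "abelian_subgroup N M"
proof -
  interpret submodule R N M by fact
  interpret M: Module.module R M by (rule module)
  have "\<ominus>\<^bsub>M\<^esub> x \<in> N" if "x \<in> N" for x
  proof -
    have "(\<ominus>\<^bsub>R\<^esub> \<one>\<^bsub>R\<^esub>) \<odot>\<^bsub>M\<^esub> x \<in> N"
      by (rule smult_closed[OF M.R.a_inv_closed[OF M.R.one_closed] that])
    moreover have "x \<in> carrier M" using that subset by blast
    ultimately show ?thesis by (metis M.smult_minus_1)
  qed
  note neg = this
  have "subgroup N (add_monoid M)"
  proof (rule M.add.subgroupI)
    show "N \<noteq> {}" using zero_closed by blast
    show "\<ominus>\<^bsub>M\<^esub> x \<in> N" if "x \<in> N" for x using that by (rule neg)
    show "x \<oplus>\<^bsub>M\<^esub> y \<in> N" if "x \<in> N" "y \<in> N" for x y using that by (rule m_closed)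
  qed (rule subset)
  then show ?thesis
    by (intro abelian_subgroupI3 additive_subgroup.intro) (auto intro: M.abelian_group_axioms)
qed

lemma quot_module_props:
  assumes N: "submodule R N M"
  shows "carrier (quot_module M N) = (\<lambda>x. N +>\<^bsub>M\<^esub> x) ` carrier M"
    and "\<And>x y. x \<in> carrier M \<Longrightarrow> y \<in> carrier M
      \<Longrightarrow> (N +>\<^bsub>M\<^esub> x) \<oplus>\<^bsub>quot_module M N\<^esub> (N +>\<^bsub>M\<^esub> y) = N +>\<^bsub>M\<^esub> (x \<oplus>\<^bsub>M\<^esub> y)"
    and "\<And>r x. r \<in> carrier R \<Longrightarrow> x \<in> carrier M
      \<Longrightarrow> r \<odot>\<^bsub>quot_module M N\<^esub> (N +>\<^bsub>M\<^esub> x) = N +>\<^bsub>M\<^esub> (r \<odot>\<^bsub>M\<^esub> x)"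
    and "\<And>x. x \<in> carrier M \<Longrightarrow> N +>\<^bsub>M\<^esub> x = \<zero>\<^bsub>quot_module M N\<^esub> \<longleftrightarrow> x \<in> N"
    and "Module.module R (quot_module M N)"
proof -
  interpret N: submodule R N M by fact
  interpret M: Module.module R M by (rule N.module)
  interpret A: abelian_subgroup N M by (rule submodule_abelian_subgroup[OF N])
  show car: "carrier (quot_module M N) = (\<lambda>x. N +>\<^bsub>M\<^esub> x) ` carrier M"
    by (auto simp: quot_module_def A_RCOSETS_def')
  show add: "(N +>\<^bsub>M\<^esub> x) \<oplus>\<^bsub>quot_module M N\<^esub> (N +>\<^bsub>M\<^esub> y) = N +>\<^bsub>M\<^esub> (x \<oplus>\<^bsub>M\<^esub> y)"
    if "x \<in> carrier M" "y \<in> carrier M" for x y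
    using A.a_rcos_sum[OF that] by (simp add: quot_module_def)
  show smult: "r \<odot>\<^bsub>quot_module M N\<^esub> (N +>\<^bsub>M\<^esub> x) = N +>\<^bsub>M\<^esub> (r \<odot>\<^bsub>M\<^esub> x)"
    if r: "r \<in> carrier R" and x: "x \<in> carrier M" for r x
  proof -
    have "N <+>\<^bsub>M\<^esub> ((\<lambda>m. r \<odot>\<^bsub>M\<^esub> m) ` (N +>\<^bsub>M\<^esub> x)) = N +>\<^bsub>M\<^esub> (r \<odot>\<^bsub>M\<^esub> x)"
    proof (intro equalityI subsetI)
      fix z assume "z \<in> N <+>\<^bsub>M\<^esub> ((\<lambda>m. r \<odot>\<^bsub>M\<^esub> m) ` (N +>\<^bsub>M\<^esub> x))"
      then obtain n n' where n: "n \<in> N" "n' \<in> N" "z = n \<oplus>\<^bsub>M\<^esub> r \<odot>\<^bsub>M\<^esub> (n' \<oplus>\<^bsub>M\<^esub> x)"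
        by (auto simp: set_add_def' a_r_coset_def')
      then have "z = (n \<oplus>\<^bsub>M\<^esub> r \<odot>\<^bsub>M\<^esub> n') \<oplus>\<^bsub>M\<^esub> r \<odot>\<^bsub>M\<^esub> x"
        using r x N.subset by (simp add: M.smult_r_distr M.a_assoc subset_iff)
      then show "z \<in> N +>\<^bsub>M\<^esub> (r \<odot>\<^bsub>M\<^esub> x)" using n r by (auto simp: a_r_coset_def')
    next
      fix z assume "z \<in> N +>\<^bsub>M\<^esub> (r \<odot>\<^bsub>M\<^esub> x)"
      then obtain n where n: "n \<in> N" "z = n \<oplus>\<^bsub>M\<^esub> r \<odot>\<^bsub>M\<^esub> x" by (auto simp: a_r_coset_def')
      then have "z = n \<oplus>\<^bsub>M\<^esub> r \<odot>\<^bsub>M\<^esub> (\<zero>\<^bsub>M\<^esub> \<oplus>\<^bsub>M\<^esub> x)" using x by simp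
      then show "z \<in> N <+>\<^bsub>M\<^esub> ((\<lambda>m. r \<odot>\<^bsub>M\<^esub> m) ` (N +>\<^bsub>M\<^esub> x))"
        using n(1) N.zero_closed unfolding set_add_def' a_r_coset_def' by blast
    qed
    then show ?thesis by (simp add: quot_module_def)
  qed
  have zero: "\<zero>\<^bsub>quot_module M N\<^esub> = N" by (simp add: quot_module_def)
  show "N +>\<^bsub>M\<^esub> x = \<zero>\<^bsub>quot_module M N\<^esub> \<longleftrightarrow> x \<in> N" if "x \<in> carrier M" for x
    unfolding zero using M.a_coset_join2[OF that] A.a_rcos_self[OF that] A.a_subgroup by blast
  have "\<zero>\<^bsub>quot_module M N\<^esub> = N +>\<^bsub>M\<^esub> \<zero>\<^bsub>M\<^esub>"
    unfolding zero using M.a_coset_join2[of "\<zero>\<^bsub>M\<^esub>"] A.a_subgroup by simp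
  then show "Module.module R (quot_module M N)"
    by (intro module_surjective_image[OF N.module car add smult])
qed

lemma module_ideal_module:
  assumes "ideal J (class_ring :: 'r::comm_ring_1 ring)"
  shows "Module.module class_ring (ideal_module class_ring J)"
proof -
  have J: "0 \<in> J" "\<And>x y. x \<in> J \<Longrightarrow> y \<in> J \<Longrightarrow> x + y \<in> J" "\<And>r x. x \<in> J \<Longrightarrow> r * x \<in> J"
    using assms unfolding ideal_class_ring_iff by auto
  have "- x \<in> J" if "x \<in> J" for x using J(3)[OF that, of "- 1"] by simp
  then show ?thesis
    using J
    by (intro module_criteria class_cring.cring_axioms)
       (auto simp: ideal_module_def add_ac distrib_left distrib_right mult.assoc intro!: bexI[of _ "- x" for x])
qed

lemma submodule_ideal_module:
  assumes "ideal J (class_ring :: 'r::comm_ring_1 ring)" "ideal K (class_ring :: 'r ring)" "K \<subseteq> J"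
  shows "submodule class_ring K (ideal_module class_ring J)"
proof (rule submodule.intro[OF module_ideal_module[OF assms(1)]])
qed (use assms(2,3) in \<open>auto simp: ideal_class_ring_iff ideal_module_def\<close>)

lemma vectorspace_restrict_scalars:
  fixes M :: "('k::field poly3, 'b, 'm) module_scheme"
  assumes "Module.module class_ring M"
  shows "vectorspace (class_ring :: 'k ring) (restrict_scalars const_poly M)"
proof -
  interpret M: Module.module class_ring M by fact
  have c: "const_poly (x + y) = const_poly x + const_poly y"
    "const_poly (x * y) = const_poly x * const_poly y" "const_poly (1 :: 'k) = 1" for x y :: 'k
    by (simp_all add: const_poly_def single_add mult_single)
  have "Module.module (class_ring :: 'k ring) (restrict_scalars const_poly M)"
  proof (rule module_criteria[OF class_cring.cring_axioms], goal_cases)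
    case 3
    show ?case unfolding restrict_scalars_def using M.r_neg by auto
  next
    case (4) show ?case unfolding restrict_scalars_def using M.smult_closed by auto
  next
    case (8) show ?case unfolding restrict_scalars_def using M.smult_assoc1 c by auto
  next
    case (9) show ?case unfolding restrict_scalars_def using M.smult_one c by auto
  next
    case (10) show ?case unfolding restrict_scalars_def using M.smult_l_distr c by auto
  next
    case (11) show ?case unfolding restrict_scalars_def using M.smult_r_distr by auto
  next
    case (5) show ?case unfolding restrict_scalars_def using M.a_comm by auto
  next
    case (6) show ?case unfolding restrict_scalars_def using M.a_assoc by auto
  qed (auto simp: restrict_scalars_def)
  then show ?thesis
    by (simp add: vectorspace_def class_field)
qed

text \<open>
  The images of the monomials with exponent in \<open>S - W\<close> form a basis: they generate since the terms in
  \<open>W\<close> are killed, and they are independent since the kernel is spanned by monomials.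
\<close>

lemma dim_monomials:
  fixes V :: "('k::field, 'v, 'm) module_scheme" and \<theta> :: "'k poly3 \<Rightarrow> 'v"
  assumes V: "vectorspace class_ring V"
    and car: "carrier V = \<theta> ` mono_ideal S"
    and add: "\<And>f g. f \<in> mono_ideal S \<Longrightarrow> g \<in> mono_ideal S \<Longrightarrow> \<theta> (f + g) = \<theta> f \<oplus>\<^bsub>V\<^esub> \<theta> g"
    and smult: "\<And>c f. f \<in> mono_ideal S \<Longrightarrow> \<theta> (const_poly c * f) = c \<odot>\<^bsub>V\<^esub> \<theta> f"
    and ker: "\<And>f. f \<in> mono_ideal S \<Longrightarrow> \<theta> f = \<zero>\<^bsub>V\<^esub> \<longleftrightarrow> f \<in> mono_ideal W"
    and fin: "finite (S - W)"
  shows "vectorspace.dim class_ring V = card (S - W)"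
proof -
  interpret V: vectorspace class_ring V by fact
  let ?D = "S - W"
  define h where "h m = \<theta> (Poly_Mapping.single m 1)" for m
  let ?p = "\<lambda>c A. \<Sum>m\<in>A. Poly_Mapping.single m (c m) :: 'k poly3"
  have lookup_p: "lookup (?p c A) m = (if m \<in> A then c m else 0)" if "finite A" for c A m
    using that by (simp add: lookup_sum lookup_single when_def)
  have pS: "?p c A \<in> mono_ideal S" if "finite A" "A \<subseteq> S" for c A
    using that by (auto simp: mono_ideal_def in_keys_iff lookup_p split: if_splits)
  have sS: "Poly_Mapping.single m c \<in> mono_ideal S" if "m \<in> S" for m and c :: 'k
    using that by (simp add: mono_ideal_def)
  have hV: "h m \<in> carrier V" if "m \<in> S" for m
    unfolding car h_def using sS[OF that] by blast
  have theta_p: "\<theta> (?p c A) = (\<Oplus>\<^bsub>V\<^esub>m\<in>A. c m \<odot>\<^bsub>V\<^esub> h m)" if "finite A" "A \<subseteq> S" for c A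
    using that
  proof (induction A)
    case empty
    have "0 \<in> (mono_ideal S :: 'k poly3 set)" "0 \<in> (mono_ideal W :: 'k poly3 set)"
      by (simp_all add: mono_ideal_def)
    then show ?case using ker[of 0] by simp
  next
    case (insert m A)
    have "Poly_Mapping.single m (c m) = const_poly (c m) * Poly_Mapping.single m 1"
      by (simp add: const_poly_def mult_single)
    then have "\<theta> (Poly_Mapping.single m (c m)) = c m \<odot>\<^bsub>V\<^esub> h m"
      using smult[OF sS[of m 1], of "c m"] insert.prems by (simp add: h_def)
    moreover have "\<theta> (?p c (insert m A)) = \<theta> (Poly_Mapping.single m (c m)) \<oplus>\<^bsub>V\<^esub> \<theta> (?p c A)"
      using insert by (simp add: add sS pS)
    moreover have "(\<lambda>m. c m \<odot>\<^bsub>V\<^esub> h m) \<in> A \<rightarrow> carrier V" "c m \<odot>\<^bsub>V\<^esub> h m \<in> carrier V"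
      using insert.prems hV by auto
    ultimately show ?case using insert by (simp add: V.finsum_insert)
  qed
  have p_zero: "c m = 0" if "\<theta> (?p c ?D) = \<zero>\<^bsub>V\<^esub>" "m \<in> ?D" for c m
  proof -
    have "?p c ?D \<in> mono_ideal W" using ker[OF pS[OF fin]] that(1) by blast
    then have "m \<notin> keys (?p c ?D)" using that(2) by (auto simp: mono_ideal_def)
    then show ?thesis using that(2) fin by (simp add: in_keys_iff lookup_p)
  qed
  have inj: "inj_on h ?D"
  proof (rule inj_onI, rule ccontr)
    fix m m' assume m: "m \<in> ?D" "m' \<in> ?D" "h m = h m'" "m \<noteq> m'"
    \<comment> \<open>If \<open>h m = h m\'\<close>, the difference of the two monomials would lie in the kernel.\<close>
    let ?f = "Poly_Mapping.single m 1 + const_poly (- 1) * Poly_Mapping.single m' (1::'k)"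
    have f: "?f = Poly_Mapping.single m 1 + Poly_Mapping.single m' (- 1)"
      by (simp add: const_poly_def mult_single)
    have 1: "const_poly (- 1) * Poly_Mapping.single m' (1::'k) \<in> mono_ideal S"
      using m by (simp add: const_poly_def mult_single sS)
    have "\<theta> ?f = h m \<oplus>\<^bsub>V\<^esub> (- 1) \<odot>\<^bsub>V\<^esub> h m"
      using add[OF sS[of m 1] 1] smult[OF sS[of m' 1]] m by (simp add: h_def)
    also have "\<dots> = 1 \<odot>\<^bsub>V\<^esub> h m \<oplus>\<^bsub>V\<^esub> (- 1) \<odot>\<^bsub>V\<^esub> h m"
      using V.smult_one[OF hV[of m]] m by simp
    also have "\<dots> = (1 + (- 1)) \<odot>\<^bsub>V\<^esub> h m"
      using V.smult_l_distr[of 1 "- 1" "h m"] hV[of m] m by simp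
    also have "\<dots> = \<zero>\<^bsub>V\<^esub>" using V.lmult_0[of "h m"] hV[of m] m by simp
    finally have "\<theta> ?f = \<zero>\<^bsub>V\<^esub>" .
    moreover have "?f \<in> mono_ideal S" unfolding f using m
      by (auto simp: mono_ideal_def dest!: subsetD[OF keys_add])
    ultimately have "?f \<in> mono_ideal W" using ker by blast
    moreover have "m \<in> keys ?f" unfolding f using m(4) by (simp add: in_keys_iff lookup_add lookup_single)
    ultimately show False using m(1) by (auto simp: mono_ideal_def)
  qed
  have lincomb: "V.lincomb a (h ` ?D) = \<theta> (?p (\<lambda>m. a (h m)) ?D)" for a
  proof -
    have "V.lincomb a (h ` ?D) = (\<Oplus>\<^bsub>V\<^esub>m\<in>?D. a (h m) \<odot>\<^bsub>V\<^esub> h m)"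
      unfolding V.lincomb_def using hV inj by (intro V.finsum_reindex) auto
    then show ?thesis using theta_p[OF fin] by simp
  qed
  have sub: "h ` ?D \<subseteq> carrier V" using hV by auto
  have "V.basis (h ` ?D)"
    unfolding V.basis_def
  proof (intro conjI sub)
    show "V.lin_indpt (h ` ?D)"
    proof (rule V.finite_lin_indpt2[OF _ sub])
      fix a assume "V.lincomb a (h ` ?D) = \<zero>\<^bsub>V\<^esub>"
      note * = p_zero[OF this[unfolded lincomb]]
      show "\<forall>v\<in>h ` ?D. a v = \<zero>\<^bsub>class_ring\<^esub>"
      proof
        fix v assume "v \<in> h ` ?D"
        then obtain m where "v = h m" "m \<in> ?D" by (rule imageE)
        then show "a v = \<zero>\<^bsub>class_ring\<^esub>" using *[of m] by simp
      qed
    qed (use fin in simp)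
    show "V.span (h ` ?D) = carrier V"
    proof
      show "V.span (h ` ?D) \<subseteq> carrier V" by (rule V.span_is_subset2[OF sub])
      show "carrier V \<subseteq> V.span (h ` ?D)"
      proof
        fix v assume "v \<in> carrier V"
        then obtain f where f: "f \<in> mono_ideal S" "v = \<theta> f" unfolding car by blast
        obtain g r where gr: "f = g + r" "keys g = keys f - W" "keys r = keys f \<inter> W"
          by (rule split_keys)
        have gS: "g \<in> mono_ideal S" and rS: "r \<in> mono_ideal S" and rW: "r \<in> mono_ideal W"
          and gD: "keys g \<subseteq> ?D"
          using f(1) unfolding mono_ideal_def mem_Collect_eq gr(2,3) by auto
        have "\<theta> r = \<zero>\<^bsub>V\<^esub>" using ker[OF rS] rW by blast
        moreover have "\<theta> g \<in> carrier V" unfolding car using gS by (rule imageI)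
        ultimately have "v = \<theta> g"
          unfolding f(2) gr(1) add[OF gS rS] by (simp only: V.r_zero)
        also have "g = ?p (lookup g) ?D"
          using gD fin by (intro poly_mapping_eqI) (auto simp: lookup_p in_keys_iff)
        also have "\<theta> \<dots> = V.lincomb (\<lambda>v. lookup g (the_inv_into ?D h v)) (h ` ?D)"
          unfolding lincomb using the_inv_into_f_f[OF inj]
          by (intro arg_cong[of _ _ \<theta>] sum.cong) auto
        finally show "v \<in> V.span (h ` ?D)"
          unfolding V.finite_span[OF finite_imageI[OF fin] sub] by auto
      qed
    qed
  qed
  then have "V.dim = card (h ` ?D)" using fin by (intro V.dim_basis) auto
  then show ?thesis using card_image[OF inj] by simp
qed

text \<open>
  Since \<open>max_ideal\<close> is spanned by the monomials other than \<open>1\<close>, the exponents of \<open>max_ideal\<close> times the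
  ideal of \<open>S\<close> are the non-minimal elements of \<open>S\<close>. Composing the two quotient maps gives a linear
  surjection as in \<open>dim_monomials\<close>.
\<close>

lemma min_gens_mono_quot:
  assumes S: "upset S" and T: "upset T" "T \<subseteq> S" and fin: "finite (S - ({d + m |d m. d \<noteq> 0 \<and> m \<in> S} \<union> T))"
  shows "min_gens (quot_module (ideal_module class_ring (mono_ideal S)) (mono_ideal T :: 'k::field poly3 set))
    = card (S - ({d + m |d m. d \<noteq> 0 \<and> m \<in> S} \<union> T))"
proof -
  let ?J = "mono_ideal S :: 'k poly3 set" and ?K = "mono_ideal T :: 'k poly3 set"
  let ?U = "{d + m |d m. d \<noteq> 0 \<and> m \<in> S}"
  let ?L = "mono_ideal ?U :: 'k poly3 set"
  define M0 where "M0 = ideal_module class_ring ?J"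
  define M1 where "M1 = quot_module M0 ?K"
  define G where "G = {r \<odot>\<^bsub>M1\<^esub> m | r m. r \<in> max_ideal \<and> m \<in> carrier M1}"
  define N where "N = ideal_times_module class_ring max_ideal M1"
  define M2 where "M2 = quot_module M1 N"
  define \<pi> where "\<pi> f = ?K +>\<^bsub>M0\<^esub> f" for f
  note idS = ideal_mono_ideal[OF S, where ?'a = 'k]
  note idT = ideal_mono_ideal[OF T(1), where ?'a = 'k]
  have upU: "upset ?U" by (rule upset_sumset[where U = "{d. d \<noteq> 0}", OF S, simplified])
  note idU = ideal_mono_ideal[OF upU, where ?'a = 'k]
  have US: "?U \<subseteq> S" using S unfolding upset_def by (clarsimp) (metis add.commute)
  have KJ: "?K \<subseteq> ?J" and LJ: "?L \<subseteq> ?J"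
    using T(2) US unfolding mono_ideal_def by blast+
  have M0: "carrier M0 = ?J" "\<And>x y. x \<oplus>\<^bsub>M0\<^esub> y = x + y" "\<And>r x. r \<odot>\<^bsub>M0\<^esub> x = r * x" "\<zero>\<^bsub>M0\<^esub> = 0"
    by (simp_all add: M0_def ideal_module_def)
  have subK: "submodule class_ring ?K M0" unfolding M0_def by (rule submodule_ideal_module[OF idS idT KJ])
  note Q1 = quot_module_props[OF subK, folded M1_def \<pi>_def, unfolded M0]
  interpret M1: Module.module class_ring M1 by (rule Q1(5))
  have car1: "carrier M1 = \<pi> ` ?J" using Q1(1) by simp
  have G: "G \<subseteq> carrier M1" unfolding G_def by auto
  have N: "N = M1.span G" by (simp add: N_def ideal_times_module_def G_def)
  have subN: "submodule class_ring N M1" unfolding N by (rule M1.span_is_submodule[OF G])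
  note Q2 = quot_module_props[OF subN, folded M2_def]
  have GL: "G \<subseteq> \<pi> ` ?L"
  proof
    fix v assume "v \<in> G"
    then obtain r f where rf: "v = r \<odot>\<^bsub>M1\<^esub> \<pi> f" "r \<in> max_ideal" "f \<in> ?J" unfolding G_def car1 by blast
    have "keys (r * f) \<subseteq> {x + y |x y. x \<in> keys r \<and> y \<in> keys f}" by (rule keys_mult)
    also have "\<dots> \<subseteq> ?U" using rf(2,3) unfolding max_ideal_eq mono_ideal_def by blast
    finally have "r * f \<in> ?L" by (simp add: mono_ideal_def)
    moreover have "v = \<pi> (r * f)" using rf Q1(3)[of r f] by simp
    ultimately show "v \<in> \<pi> ` ?L" by blast
  qed
  have "submodule class_ring (\<pi> ` ?L) M1"
  proof (rule submodule.intro[OF Q1(5)])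
    show "\<pi> ` ?L \<subseteq> carrier M1" unfolding car1 using LJ by blast
    have L: "0 \<in> ?L" "\<And>x y. x \<in> ?L \<Longrightarrow> y \<in> ?L \<Longrightarrow> x + y \<in> ?L" "\<And>r x. x \<in> ?L \<Longrightarrow> r * x \<in> ?L"
      using idU unfolding ideal_class_ring_iff by auto
    have "\<pi> 0 = \<zero>\<^bsub>M1\<^esub>" using Q1(4)[of 0] idS idT unfolding ideal_class_ring_iff by blast
    then show "\<zero>\<^bsub>M1\<^esub> \<in> \<pi> ` ?L" using L(1) by force
    show "v \<oplus>\<^bsub>M1\<^esub> w \<in> \<pi> ` ?L" if "v \<in> \<pi> ` ?L" "w \<in> \<pi> ` ?L" for v w
    proof -
      from that(1) obtain f where f: "v = \<pi> f" "f \<in> ?L" by (rule imageE)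
      from that(2) obtain g where g: "w = \<pi> g" "g \<in> ?L" by (rule imageE)
      have "v \<oplus>\<^bsub>M1\<^esub> w = \<pi> (f + g)"
        unfolding f(1) g(1) by (rule Q1(2)[OF subsetD[OF LJ f(2)] subsetD[OF LJ g(2)]])
      then show ?thesis using imageI[OF L(2)[OF f(2) g(2)]] by simp
    qed
    show "r \<odot>\<^bsub>M1\<^esub> v \<in> \<pi> ` ?L" if "r \<in> carrier class_ring" "v \<in> \<pi> ` ?L" for r v
    proof -
      from that(2) obtain f where f: "v = \<pi> f" "f \<in> ?L" by (rule imageE)
      have "r \<odot>\<^bsub>M1\<^esub> v = \<pi> (r * f)"
        unfolding f(1) by (rule Q1(3)[OF that(1) subsetD[OF LJ f(2)]])
      then show ?thesis using imageI[OF L(3)[OF f(2)]] by simp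
    qed
  qed
  then have NL: "N \<subseteq> \<pi> ` ?L" unfolding N by (intro M1.span_is_subset GL)
  interpret N: submodule class_ring N M1 by (rule subN)
  let ?P = "{f \<in> ?J. \<pi> f \<in> N}"
  have idP: "ideal ?P class_ring"
    unfolding ideal_class_ring_iff
  proof (intro conjI ballI allI)
    have J: "0 \<in> ?J" "\<And>x y. x \<in> ?J \<Longrightarrow> y \<in> ?J \<Longrightarrow> x + y \<in> ?J" "\<And>r x. x \<in> ?J \<Longrightarrow> r * x \<in> ?J"
      using idS unfolding ideal_class_ring_iff by auto
    have "\<pi> 0 = \<zero>\<^bsub>M1\<^esub>" using Q1(4)[of 0] idS idT unfolding ideal_class_ring_iff by blast
    then show "0 \<in> ?P" using J(1) by simp
    show "x + y \<in> ?P" if "x \<in> ?P" "y \<in> ?P" for x y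
      using that Q1(2)[of x y] N.m_closed[of "\<pi> x" "\<pi> y"] J(2)[of x y] by auto
    show "r * x \<in> ?P" if "x \<in> ?P" for r x
      using that Q1(3)[of r x] N.smult_closed[of r "\<pi> x"] J(3)[of x r] by auto
  qed
  have LP: "?L \<subseteq> ?P"
  proof (rule mono_ideal_subset[OF idP])
    fix u assume "u \<in> ?U"
    then obtain d m where dm: "u = d + m" "d \<noteq> 0" "m \<in> S" by blast
    have m: "Poly_Mapping.single m (1::'k) \<in> ?J" using dm by (simp add: mono_ideal_def)
    have d: "Poly_Mapping.single d (1::'k) \<in> max_ideal" using dm by (simp add: max_ideal_eq mono_ideal_def)
    have u: "Poly_Mapping.single u (1::'k) = Poly_Mapping.single d 1 * Poly_Mapping.single m 1"
      by (simp add: dm mult_single)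
    have "\<pi> (Poly_Mapping.single u 1) = Poly_Mapping.single d 1 \<odot>\<^bsub>M1\<^esub> \<pi> (Poly_Mapping.single m 1)"
      unfolding u using Q1(3)[of "Poly_Mapping.single d 1" "Poly_Mapping.single m 1"] m by simp
    also have "\<dots> \<in> G" unfolding G_def car1 using d m by blast
    also have "G \<subseteq> N" unfolding N by (rule M1.in_own_span[OF G])
    finally have "\<pi> (Poly_Mapping.single u 1) \<in> N" .
    moreover have "Poly_Mapping.single u 1 \<in> ?J" using \<open>u \<in> ?U\<close> US by (auto simp: mono_ideal_def)
    ultimately show "Poly_Mapping.single u 1 \<in> ?P" by simp
  qed
  have pi_N: "\<pi> f \<in> N \<longleftrightarrow> f \<in> mono_ideal (?U \<union> T)" if f: "f \<in> ?J" for f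
  proof
    assume "\<pi> f \<in> N"
    then have "\<pi> f \<in> \<pi> ` ?L" by (rule subsetD[OF NL])
    then obtain g where g: "\<pi> f = \<pi> g" "g \<in> ?L" by (rule imageE)
    have gJ: "g \<in> ?J" using g(2) LJ by (rule subsetD[rotated])
    then have mgJ: "- 1 * g \<in> ?J" using idS unfolding ideal_class_ring_iff by blast
    have "\<pi> (f + - 1 * g) = \<pi> f \<oplus>\<^bsub>M1\<^esub> \<pi> (- 1 * g)" using Q1(2)[OF f mgJ] by simp
    also have "\<dots> = \<pi> (g + - 1 * g)" unfolding g(1) using Q1(2)[OF gJ mgJ] by simp
    also have "\<dots> = \<zero>\<^bsub>M1\<^esub>" using Q1(4)[of 0] idS idT unfolding ideal_class_ring_iff by simp
    finally have "f + - 1 * g \<in> ?K"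
      using Q1(4)[of "f + - 1 * g"] f mgJ idS unfolding ideal_class_ring_iff by blast
    moreover have "f = (f + - 1 * g) + g" by simp
    ultimately have "keys f \<subseteq> T \<union> ?U"
      using keys_add[of "f + - 1 * g" g] g(2) unfolding mono_ideal_def by auto
    then show "f \<in> mono_ideal (?U \<union> T)" by (auto simp: mono_ideal_def)
  next
    assume fU: "f \<in> mono_ideal (?U \<union> T)"
    obtain g h where gh: "f = g + h" "keys g = keys f - T" "keys h = keys f \<inter> T"
      by (rule split_keys)
    have "keys f \<subseteq> ?U \<union> T" using fU by (simp add: mono_ideal_def)
    then have g: "g \<in> ?L" and h: "h \<in> ?K" unfolding mono_ideal_def mem_Collect_eq gh(2,3) by blast+
    have "\<pi> h = \<zero>\<^bsub>M1\<^esub>" using Q1(4) h KJ by blast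
    moreover have "\<zero>\<^bsub>M1\<^esub> \<in> N" by (rule N.zero_closed)
    moreover have "\<pi> g \<in> N" using g LP by blast
    moreover have "\<pi> f = \<pi> g \<oplus>\<^bsub>M1\<^esub> \<pi> h" unfolding gh(1) using Q1(2)[of g h] g h LJ KJ by blast
    ultimately show "\<pi> f \<in> N" by (metis N.m_closed)
  qed
  let ?V = "restrict_scalars const_poly M2 :: ('k, 'k poly3 set set) module"
  have "vectorspace.dim (class_ring :: 'k ring) ?V = card (S - (?U \<union> T))"
  proof (rule dim_monomials[OF vectorspace_restrict_scalars[OF Q2(5)] _ _ _ _ fin])
    let ?\<theta> = "\<lambda>f. N +>\<^bsub>M1\<^esub> \<pi> f"
    have pi1: "\<pi> f \<in> carrier M1" if "f \<in> ?J" for f unfolding car1 using that by blast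
    have V: "carrier ?V = carrier M2" "\<And>x y. x \<oplus>\<^bsub>?V\<^esub> y = x \<oplus>\<^bsub>M2\<^esub> y"
      "\<And>c x. c \<odot>\<^bsub>?V\<^esub> x = const_poly c \<odot>\<^bsub>M2\<^esub> x" "\<zero>\<^bsub>?V\<^esub> = \<zero>\<^bsub>M2\<^esub>"
      by (simp_all only: restrict_scalars_def partial_object.simps monoid.simps ring_record_simps module.simps)
    have r: "r \<in> carrier class_ring" for r :: "'k poly3" by simp
    show "carrier ?V = ?\<theta> ` ?J"
      unfolding V(1) Q2(1) car1 image_image ..
    show "?\<theta> (f + g) = ?\<theta> f \<oplus>\<^bsub>?V\<^esub> ?\<theta> g" if "f \<in> ?J" "g \<in> ?J" for f g
      unfolding V(2) Q2(2)[OF pi1[OF that(1)] pi1[OF that(2)]] Q1(2)[OF that] ..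
    show "?\<theta> (const_poly c * f) = c \<odot>\<^bsub>?V\<^esub> ?\<theta> f" if "f \<in> ?J" for c f
      unfolding V(3) Q2(3)[OF r pi1[OF that]] Q1(3)[OF r that] ..
    show "?\<theta> f = \<zero>\<^bsub>?V\<^esub> \<longleftrightarrow> f \<in> mono_ideal (?U \<union> T)" if "f \<in> ?J" for f
      unfolding V(4) Q2(4)[OF pi1[OF that]] by (rule pi_N[OF that])
  qed
  then show ?thesis
    unfolding min_gens_def M2_def N_def M1_def M0_def .
qed

section \<open>The symbolic defect\<close>

lemma triple_coords: "triple e (lookup m (e + 1)) (lookup m (e + 2)) (lookup m e) = m"
  unfolding poly_mapping_eq_iff fun_eq_iff three_all_rotate[where e = e] lookup_triple by simp

lemma sdef_eq_card:
  assumes w: "\<And>e. w e > 0"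
  shows "sdef (mono_ideal (symb w 1) :: 'k::field poly3 set) n
    = card (sdef_exps (w e) (w (e + 1)) (w (e + 2)) n)" (is "_ = card ?D")
proof -
  let ?S = "symb_exps (w e) (w (e + 1)) (w (e + 2)) n"
  let ?U = "{d + m |d m. d \<noteq> 0 \<and> m \<in> symb w n}"
  let ?X = "symb w n - (?U \<union> pow_exps w n)"
  have U: "m \<in> ?U \<longleftrightarrow>
      (0 < lookup m (e + 1) \<and> (lookup m (e + 1) - 1, lookup m (e + 2), lookup m e) \<in> ?S)
    \<or> (0 < lookup m (e + 2) \<and> (lookup m (e + 1), lookup m (e + 2) - 1, lookup m e) \<in> ?S)
    \<or> (0 < lookup m e \<and> (lookup m (e + 1), lookup m (e + 2), lookup m e - 1) \<in> ?S)"
    (is "_ \<longleftrightarrow> ?P1 \<or> ?P2 \<or> ?P3") for m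
  proof
    assume "m \<in> ?U"
    then obtain d m' where m: "m = d + m'" "d \<noteq> 0" and "m' \<in> symb w n" by blast
    then have S: "coords e m' \<in> ?S" using symb_coords by blast
    have "\<not> (\<forall>i. lookup d i = 0)" using m(2) by (simp add: poly_mapping_eq_iff fun_eq_iff)
    then consider "0 < lookup d (e + 1)" | "0 < lookup d (e + 2)" | "0 < lookup d e"
      unfolding three_all_rotate[where e = e] by blast
    then show "?P1 \<or> ?P2 \<or> ?P3"
    proof cases
      case 1
      then have ?P1 unfolding m(1) lookup_add by (intro conjI symb_exps_mono[OF S]) simp_all
      then show ?thesis ..
    next
      case 2
      then have ?P2 unfolding m(1) lookup_add by (intro conjI symb_exps_mono[OF S]) simp_all
      then show ?thesis by blast
    next
      case 3
      then have ?P3 unfolding m(1) lookup_add by (intro conjI symb_exps_mono[OF S]) simp_all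
      then show ?thesis by blast
    qed
  next
    have *: "m \<in> ?U" if "(i, j, k) \<in> ?S" and eq: "m = Poly_Mapping.single l 1 + triple e i j k" for i j k l
    proof -
      have "triple e i j k \<in> symb w n" unfolding symb_coords[of _ _ _ e] lookup_triple by (rule that(1))
      moreover have "Poly_Mapping.single l (1::nat) \<noteq> 0" by (metis lookup_single_eq lookup_zero one_neq_zero)
      ultimately show ?thesis using eq by blast
    qed
    assume "?P1 \<or> ?P2 \<or> ?P3"
    then show "m \<in> ?U"
    proof (elim disjE conjE)
      assume pos: "0 < lookup m (e + 1)" and S: "(lookup m (e + 1) - 1, lookup m (e + 2), lookup m e) \<in> ?S"
      show ?thesis
      proof (rule *[OF S, of "e + 1"])
        show "m = Poly_Mapping.single (e + 1) 1 + triple e (lookup m (e + 1) - 1) (lookup m (e + 2)) (lookup m e)"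
          unfolding poly_mapping_eq_iff fun_eq_iff three_all_rotate[where e = e] lookup_add lookup_triple
          using pos three_neq[of e] by (auto simp: lookup_single when_def)
      qed
    next
      assume pos: "0 < lookup m (e + 2)" and S: "(lookup m (e + 1), lookup m (e + 2) - 1, lookup m e) \<in> ?S"
      show ?thesis
      proof (rule *[OF S, of "e + 2"])
        show "m = Poly_Mapping.single (e + 2) 1 + triple e (lookup m (e + 1)) (lookup m (e + 2) - 1) (lookup m e)"
          unfolding poly_mapping_eq_iff fun_eq_iff three_all_rotate[where e = e] lookup_add lookup_triple
          using pos three_neq[of e] by (auto simp: lookup_single when_def)
      qed
    next
      assume pos: "0 < lookup m e" and S: "(lookup m (e + 1), lookup m (e + 2), lookup m e - 1) \<in> ?S"
      show ?thesis
      proof (rule *[OF S, of e])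
        show "m = Poly_Mapping.single e 1 + triple e (lookup m (e + 1)) (lookup m (e + 2)) (lookup m e - 1)"
          unfolding poly_mapping_eq_iff fun_eq_iff three_all_rotate[where e = e] lookup_add lookup_triple
          using pos three_neq[of e] by (auto simp: lookup_single when_def)
      qed
    qed
  qed
  have X: "m \<in> ?X \<longleftrightarrow> coords e m \<in> ?D" for m
    unfolding Diff_iff Un_iff U symb_coords[of m w n e] pow_exps_coords[of m w n e]
      sdef_exps_def min_exps_def mem_Collect_eq prod.case
    by blast
  have "bij_betw (coords e) ?X ?D"
  proof (rule bij_betw_byWitness[where f' = "\<lambda>(i, j, k). triple e i j k"])
    show "\<forall>m\<in>?X. (case coords e m of (i, j, k) \<Rightarrow> triple e i j k) = m"
      by (intro ballI) (simp only: prod.case triple_coords)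
    have "coords e (case t of (i, j, k) \<Rightarrow> triple e i j k) = t" for t
      by (cases t) (simp only: prod.case lookup_triple)
    then show "\<forall>t\<in>?D. coords e (case t of (i, j, k) \<Rightarrow> triple e i j k) = t" by blast
    show "coords e ` ?X \<subseteq> ?D" using X by blast
    show "(\<lambda>(i, j, k). triple e i j k) ` ?D \<subseteq> ?X"
    proof (rule image_subsetI)
      fix t assume t: "t \<in> ?D"
      obtain i j k where ijk: "t = (i, j, k)" by (cases t)
      have "coords e (triple e i j k) \<in> ?D" using t unfolding ijk lookup_triple .
      then show "(case t of (i, j, k) \<Rightarrow> triple e i j k) \<in> ?X" unfolding ijk prod.case X .
    qed
  qed
  moreover have "finite ?D" unfolding sdef_exps_def by (intro finite_Diff finite_min_exps w)
  ultimately have "finite ?X" and card: "card ?X = card ?D"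
    by (simp_all only: bij_betw_finite bij_betw_same_card)
  have "ideal_power (mono_ideal (symb w 1)) n = (mono_ideal (pow_exps w n) :: 'k poly3 set)"
    by (simp only: ideal_power_mono_ideal[OF upset_symb] nsum_symb[OF w])
  then show ?thesis
    unfolding sdef_def symbolic_power_symb[OF w] card[symmetric]
    using min_gens_mono_quot[OF upset_symb upset_pow_exps[OF w] pow_exps_subset_symb[OF w] \<open>finite ?X\<close>]
    by simp
qed

lemma facet_1:
  assumes "w e > 0"
  shows "facet w e 1 = {m. w e \<le> lookup m (e + 1) \<or> 0 < lookup m (e + 2)}"
  using assms by (auto simp: facet_def Suc_le_eq div_greater_zero_iff)

lemma real_vertex:
  assumes "c > 0"
  shows "real (vertex a b c) = real a * (real b * real c - real b + 1)"
proof -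
  obtain c' where "c = Suc c'" using assms gr0_implies_Suc by blast
  then show ?thesis by (simp add: vertex_def algebra_simps)
qed

theorem mainTheorem3:
  fixes a b c :: nat and I :: "'k::field poly3 set" and \<alpha> \<beta> \<gamma> :: real
  assumes "a > 0" and "b > 0" and "c > 0"
    and "I = Idl\<^bsub>class_ring\<^esub> {varx ^ a, vary} \<inter> Idl\<^bsub>class_ring\<^esub> {vary ^ b, varz}
           \<inter> Idl\<^bsub>class_ring\<^esub> {varz ^ c, varx}"
    and "\<alpha> = real a * (real b * real c - real b + 1) / (real a * real b * real c + 1)"
    and "\<beta> = real b * (real a * real c - real c + 1) / (real a * real b * real c + 1)"
    and "\<gamma> = real c * (real a * real b - real a + 1) / (real a * real b * real c + 1)"
  shows "(\<lambda>n. real (sdef I n) / ((\<alpha> + \<beta> + \<gamma>) * real n)) \<longlonglongrightarrow> 1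
       \<and> is_quasi_period (sdef I) (a * b * c + 1)"
proof -
  define w :: "3 \<Rightarrow> nat" where "w e = (if e = 0 then b else if e = 1 then c else a)" for e
  have w: "w e > 0" for e using assms(1-3) by (simp add: w_def)
  have w_vals: "w 2 = a" "w (2 + 1) = b" "w (2 + 2) = c" "w 0 = b" "w 1 = c"
    by (simp_all add: w_def)
  have "m \<in> symb w 1 \<longleftrightarrow> m \<in> facet w 2 1 \<inter> facet w 0 1 \<inter> facet w 1 1" for m
    unfolding symb_def INT_iff ball_UNIV three_all Int_iff by blast
  then have "symb w 1 = facet w 2 1 \<inter> facet w 0 1 \<inter> facet w 1 1" by blast
  also have "\<dots> = {m. a \<le> lookup m 0 \<or> 0 < lookup m 1} \<inter> {m. b \<le> lookup m 1 \<or> 0 < lookup m 2}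
      \<inter> {m. c \<le> lookup m 2 \<or> 0 < lookup m 0}"
    unfolding facet_1[of w, OF w] w_vals by (simp add: three_wrap)
  finally have symb1: "symb w 1 = \<dots>" .
  have I: "I = mono_ideal (symb w 1)"
    unfolding symb1 assms(4) genideal_var_powers mono_ideal_Int ..
  have sdef: "sdef I n = card (sdef_exps a b c n)" for n
    unfolding I using sdef_eq_card[where w = w and n = n and e = 2, OF w] by (simp only: w_vals)
  let ?N = "period a b c"
  define \<sigma> where "\<sigma> = real (vertex a b c + vertex b c a + vertex c a b) / real ?N"
  obtain h where h: "\<And>n. n \<ge> ?N \<Longrightarrow> real (card (sdef_exps a b c n)) = h (n mod ?N) + \<sigma> * real n"
    using card_sdef_exps[OF assms(1-3)] unfolding \<sigma>_def by blast
  have N: "real ?N = real a * real b * real c + 1" "?N > 0" by (simp_all add: period_def)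
  have \<sigma>: "\<alpha> + \<beta> + \<gamma> = \<sigma>"
    unfolding assms(5-7) \<sigma>_def N(1) of_nat_add real_vertex[OF assms(1)] real_vertex[OF assms(2)]
      real_vertex[OF assms(3)] add_divide_distrib
    by (simp add: mult.commute)
  have "vertex a b c > 0" using vertex_ge(1)[OF assms(1-3)] assms(1) by linarith
  then have "\<sigma> > 0" unfolding \<sigma>_def using N(2) by (intro divide_pos_pos) simp_all
  have ev: "\<forall>\<^sub>F n in sequentially. n \<ge> ?N \<and> n > 0"
    by (intro eventually_conj eventually_ge_at_top eventually_gt_at_top)
  have "is_quasi_period (sdef I) ?N"
    unfolding is_quasi_period_def
  proof (intro conjI exI[of _ "\<lambda>r. [:h r, \<sigma>:]"])
    show "\<forall>\<^sub>F n in sequentially. real (sdef I n) = poly [:h (n mod ?N), \<sigma>:] (real n)"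
      using ev by eventually_elim (simp add: sdef h)
  qed (rule N)
  moreover have "(\<lambda>n. real (sdef I n) / (\<sigma> * real n)) \<longlonglongrightarrow> 1"
  proof -
    \<comment> \<open>The deviation from the linear function takes finitely many values, one for each residue.\<close>
    define B where "B = Max ((\<lambda>r. \<bar>h r\<bar>) ` {..<?N})"
    have B: "\<bar>h (n mod ?N)\<bar> \<le> B" for n
      unfolding B_def using N(2) by (intro Max_ge) auto
    have "B \<ge> 0" using B[of 0] by linarith
    have "(\<lambda>n. h (n mod ?N) / (\<sigma> * real n)) \<longlonglongrightarrow> 0"
    proof (rule tendsto_0_le[where K = 1])
      show "(\<lambda>n. (B / \<sigma>) / real n) \<longlonglongrightarrow> 0" by (rule lim_const_over_n)
      have "norm (h (n mod ?N) / (\<sigma> * real n)) \<le> norm ((B / \<sigma>) / real n) * 1" for n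
        using B[of n] \<open>\<sigma> > 0\<close> \<open>B \<ge> 0\<close> by (simp add: abs_mult divide_right_mono)
      then show "\<forall>\<^sub>F n in sequentially. norm (h (n mod ?N) / (\<sigma> * real n)) \<le> norm ((B / \<sigma>) / real n) * 1"
        by (intro always_eventually allI)
    qed
    then have "(\<lambda>n. h (n mod ?N) / (\<sigma> * real n) + 1) \<longlonglongrightarrow> 1"
      using tendsto_add[OF _ tendsto_const[of "1 :: real"]] by fastforce
    moreover have "\<forall>\<^sub>F n in sequentially. h (n mod ?N) / (\<sigma> * real n) + 1 = real (sdef I n) / (\<sigma> * real n)"
      using ev by eventually_elim (use \<open>\<sigma> > 0\<close> in \<open>simp add: sdef h add_divide_distrib\<close>)
    ultimately show ?thesis by (rule Lim_transform_eventually)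
  qed
  ultimately show ?thesis unfolding \<sigma> by (simp add: period_def)
qed

end
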